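(* For every $\varepsilon>0$ and every integer $g$, there exist a finite graph $G$ of girth at least $g$ and a probability distribution $D$ with finite support over weight functions $w:E(G)\to\mathbb{R}_{>0}$ such that every (randomized) algorithm $a$ for the graphic matroid secretary problem on $G$ satisfies $$\mathbb{E}_{w\sim D}\left[\frac{\mathbb{E}[w(a(G,w))]}{OPT(G,w)}\right]<\frac1e+\varepsilon,$$ where the inner expectation is over the uniformly random arrival order and the algorithm's randomness. Consequently, for every $g$, no algorithm for the graphic matroid secretary problem on graphs of girth at least $g$ achieves a competitive ratio smaller than $e$.
   Context: Graphic matroid secretary problem: edges of a fixed known graph $G$ carry weights; edges arrive one at a time in uniformly random order, revealing their weight; the algorithm must irrevocably accept or reject each edge on arrival, keeping the accepted set acyclic. The algorithm may know $G$ and $D$ in advance and may be randomized. $w(a(G,w))$ denotes the total weight of edges accepted by $a$ and $OPT(G,w)$ the maximum weight of an acyclic edge set. The girth of a graph is the length of its shortest cycle. An algorithm is $\alpha$-competitive on a family of weighted graphs if $\alpha\,\mathbb{E}[ALG]\ge OPT$ for every member. *)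

theory Defs
  imports "HOL-Probability.Probability"
begin

type_synonym edge = "nat set"
type_synonym weight = "edge \<Rightarrow> real"

definition simple_graph :: "edge set \<Rightarrow> bool" where
  "simple_graph E \<longleftrightarrow> finite E \<and> (\<forall>e\<in>E. card e = 2)"

definition is_cycle :: "edge set \<Rightarrow> nat list \<Rightarrow> bool" where
  "is_cycle F vs \<longleftrightarrow> length vs \<ge> 3 \<and> distinct vs \<and>
     (\<forall>i < length vs. {vs ! i, vs ! ((i + 1) mod length vs)} \<in> F)"

definition acyclic_edges :: "edge set \<Rightarrow> bool" where
  "acyclic_edges F \<longleftrightarrow> \<not> (\<exists>vs. is_cycle F vs)"

text \<open>Girth at least g: every cycle has length at least g (forests have infinite girth).\<close>
definition girth_at_least :: "edge set \<Rightarrow> int \<Rightarrow> bool" where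
  "girth_at_least E g \<longleftrightarrow> (\<forall>vs. is_cycle E vs \<longrightarrow> int (length vs) \<ge> g)"

definition OPT :: "edge set \<Rightarrow> weight \<Rightarrow> real" where
  "OPT E w = Max {sum w F | F. F \<subseteq> E \<and> acyclic_edges F}"

text \<open>History seen by the online algorithm: arrived edges, their revealed weights,
  and the algorithm's own decisions (True = accepted).\<close>
type_synonym history = "(edge \<times> real \<times> bool) list"

text \<open>A randomized online algorithm in behavioural form: given the history, the
  current edge and its weight, the probability of accepting it.\<close>
type_synonym policy = "history \<Rightarrow> edge \<Rightarrow> real \<Rightarrow> real"

definition valid_policy :: "policy \<Rightarrow> bool" where
  "valid_policy p \<longleftrightarrow> (\<forall>h e x. 0 \<le> p h e x \<and> p h e x \<le> 1)"

definition accepted :: "history \<Rightarrow> edge set" where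
  "accepted h = {e. (\<exists>x. (e, x, True) \<in> set h)}"

text \<open>Expected weight collected by the policy on the remaining arrival sequence,
  over the algorithm's randomness. An acceptance that would close a cycle is
  impossible, so such an edge is rejected.\<close>
fun exp_gain :: "policy \<Rightarrow> weight \<Rightarrow> history \<Rightarrow> edge list \<Rightarrow> real" where
  "exp_gain p w h [] = 0"
| "exp_gain p w h (e # es) =
     (if acyclic_edges (insert e (accepted h)) then
        p h e (w e) * (w e + exp_gain p w (h @ [(e, w e, True)]) es)
        + (1 - p h e (w e)) * exp_gain p w (h @ [(e, w e, False)]) es
      else exp_gain p w (h @ [(e, w e, False)]) es)"

definition arrival_orders :: "edge set \<Rightarrow> edge list set" where
  "arrival_orders E = {xs. distinct xs \<and> set xs = E}"

definition ALG :: "policy \<Rightarrow> edge set \<Rightarrow> weight \<Rightarrow> real" where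
  "ALG p E w = measure_pmf.expectation (pmf_of_set (arrival_orders E))
                 (\<lambda>xs. exp_gain p w [] xs)"

definition pos_weights :: "edge set \<Rightarrow> weight \<Rightarrow> bool" where
  "pos_weights E w \<longleftrightarrow> (\<forall>e\<in>E. w e > 0)"

end

theory Submission
  imports Defs
begin

text \<open>
  Take a bipartite graph with parts \<open>A\<close> and \<open>B\<close> and large girth in which every vertex of \<open>A\<close>
  has degree \<open>d\<close> and \<open>A\<close> is much larger than \<open>B\<close>. A forest consists of at most one edge per star
  of a vertex in \<open>A\<close> plus at most \<open>card B\<close> further edges, so up to a negligible
  error an algorithm plays one secretary problem with \<open>d\<close> items in each star, while \<open>OPT\<close> collects
  the maximum of every star.

  An edge of level \<open>n\<close> has weight \<open>K ^ n\<close> with \<open>K\<close> large, so only the maximum of a star counts.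
  Under the (improper) distribution on injective level sequences of length \<open>k\<close> with maximum \<open>m\<close>
  that has density \<open>fact (m - k) / (k * fact m)\<close> for every \<open>k\<close>, the observed levels carry no information beyond the
  relative ranks, and no rule stops at the maximum with probability exceeding \<open>1/e + ln d / d\<close>.
  Truncating the levels at a large \<open>N\<close> changes masses by a factor close to one, because the
  harmonic series diverges. Finally the product of these densities over all stars is tilted by
  \<open>OPT\<close>, which turns the expected ratio into the ratio of the expectations.
\<close>

section \<open>Forests and bipartite graphs with stars\<close>

text \<open>The obstacle is that a policy sees weights, not ranks, and could learn from them. The
  density makes the past useless: the mass of \<open>k\<close> seen levels with maximum
  \<open>m\<close> splits into the share \<open>k / (k + 1)\<close> for a next level below
  \<open>m\<close> and \<open>1 / (k + 1)\<close> for a new record, as for relative ranks alone. The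
  formula with factorials solves this recursion; the second share is a telescoping sum. At
  \<open>k = 1\<close> it equals \<open>1 / m\<close>, whose sum diverges, which is why the mass is
  improper. The bound on a policy carries the harmonic sum from 1, the total mass at least the one
  from \<open>d\<close>, and the two are comparable for large \<open>N\<close>.

  Different stars have maxima of very different sizes. Hence each density is divided by the largest
  weight of its star before the product is formed: weighting the joint density by the maximum of one
  star restores the density of that star and leaves a factor free of its levels. Both sides of the
  comparison become sums over stars, and since \<open>OPT\<close> is at least the sum of the maxima,
  the normalising constant of the tilted distribution dominates the sum of the star masses.\<close>

lemma successively_conv_nth:
  "successively P xs \<longleftrightarrow> (\<forall>i. Suc i < length xs \<longrightarrow> P (xs ! i) (xs ! Suc i))"
proof (induction xs rule: induct_list012)
  case (3 x y zs)
  have "(\<forall>i. Suc i < length (x # y # zs) \<longrightarrow> P ((x # y # zs) ! i) ((x # y # zs) ! Suc i)) \<longleftrightarrow>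
    P x y \<and> (\<forall>i. Suc i < length (y # zs) \<longrightarrow> P ((y # zs) ! i) ((y # zs) ! Suc i))"
    (is "(\<forall>i. ?Q i) \<longleftrightarrow> ?r")
  proof -
    have "(\<forall>i. ?Q i) \<longleftrightarrow> ?Q 0 \<and> (\<forall>i. ?Q (Suc i))" by (metis not0_implies_Suc)
    then show ?thesis by simp
  qed
  then show ?case using 3 by simp
qed auto

abbreviation walk :: "edge set \<Rightarrow> nat list \<Rightarrow> bool" where
  "walk F \<equiv> successively (\<lambda>u v. {u, v} \<in> F)"

lemma is_cycle_Cons:
  "is_cycle F (v # q) \<longleftrightarrow>
     2 \<le> length q \<and> distinct (v # q) \<and> walk F (v # q) \<and> {last q, v} \<in> F"
proof -
  let ?vs = "v # q"
  have "(\<forall>i < length ?vs. {?vs ! i, ?vs ! ((i + 1) mod length ?vs)} \<in> F) \<longleftrightarrow>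
      walk F ?vs \<and> {last q, v} \<in> F" if "2 \<le> length q"
  proof -
    have "(\<forall>i < length ?vs. {?vs ! i, ?vs ! ((i + 1) mod length ?vs)} \<in> F) \<longleftrightarrow>
      (\<forall>i < length q. {?vs ! i, ?vs ! ((i + 1) mod length ?vs)} \<in> F) \<and>
       {?vs ! length q, ?vs ! ((length q + 1) mod length ?vs)} \<in> F"
      by (auto simp: less_Suc_eq)
    also have "?vs ! length q = last q"
      using that by (cases q rule: rev_cases) (auto simp: nth_Cons' nth_append)
    also have "?vs ! ((length q + 1) mod length ?vs) = v" by simp
    also have "(\<forall>i < length q. {?vs ! i, ?vs ! ((i + 1) mod length ?vs)} \<in> F) \<longleftrightarrow> walk F ?vs"
      by (auto simp: successively_conv_nth)
    finally show ?thesis .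
  qed
  then show ?thesis by (auto simp: is_cycle_def)
qed

lemma is_cycle_rotate:
  assumes "is_cycle F vs"
  shows "is_cycle F (rotate n vs)"
proof -
  let ?l = "length vs"
  have l: "0 < ?l" using assms by (auto simp: is_cycle_def)
  have "{rotate n vs ! i, rotate n vs ! ((i + 1) mod ?l)} \<in> F" if "i < ?l" for i
  proof -
    have "rotate n vs ! i = vs ! ((n + i) mod ?l)"
      using that by (rule nth_rotate)
    moreover have "rotate n vs ! ((i + 1) mod ?l) = vs ! (((n + i) mod ?l + 1) mod ?l)"
      using l by (subst nth_rotate) (auto simp: mod_simps add_ac)
    ultimately show ?thesis using assms l by (simp add: is_cycle_def)
  qed
  then show ?thesis using assms by (simp add: is_cycle_def)
qed

lemma cycle_start_at:
  assumes "is_cycle F vs" "v \<in> set vs"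
  obtains q where "is_cycle F (v # q)" "set (v # q) = set vs" "length (v # q) = length vs"
proof -
  obtain i where i: "i < length vs" "vs ! i = v" using assms(2) by (auto simp: in_set_conv_nth)
  have ne: "vs \<noteq> []" using i by auto
  have "hd (rotate i vs) = v" using i ne by (simp add: hd_rotate_conv_nth)
  then have "rotate i vs = v # tl (rotate i vs)"
    using ne by (metis list.collapse rotate_is_Nil_conv)
  then show thesis
    using that is_cycle_rotate[OF assms(1), of i] by (metis length_rotate set_rotate)
qed

text \<open>Rotated to start at \<open>v\<close>, the cycle enters \<open>v\<close> from
  \<open>last q\<close> and leaves to \<open>hd q\<close>, which differ because \<open>q\<close> has
  at least two vertices.\<close>

lemma cycle_edges_at:
  assumes "is_cycle F vs" "v \<in> set vs"
  obtains e e' where "e \<in> F" "e' \<in> F" "e \<noteq> e'" "v \<in> e" "v \<in> e'"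
proof -
  obtain q where q: "is_cycle F (v # q)" by (rule cycle_start_at[OF assms])
  then have "2 \<le> length q" "distinct (v # q)" "walk F (v # q)" and F2: "{last q, v} \<in> F"
    by (auto simp: is_cycle_Cons)
  then obtain a b r where r: "q = a # b # r"
    by (metis Suc_le_length_iff numeral_2_eq_2)
  have F1: "{v, a} \<in> F" using \<open>walk F (v # q)\<close> r by simp
  have "last q \<noteq> a" using \<open>distinct (v # q)\<close> r by (metis distinct.simps(2) last_ConsR last_in_set list.distinct(1))
  moreover have "v \<noteq> a" using \<open>distinct (v # q)\<close> r by auto
  ultimately have "{v, a} \<noteq> {last q, v}" by (auto simp: doubleton_eq_iff)
  then show thesis using F1 F2 that by blast
qed

lemma acyclic_edges_mono:
  assumes "acyclic_edges F" "F' \<subseteq> F"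
  shows "acyclic_edges F'"
proof -
  have "is_cycle F vs" if "is_cycle F' vs" for vs
    using that assms(2) by (auto simp: is_cycle_def)
  then show ?thesis using assms(1) by (auto simp: acyclic_edges_def)
qed

lemma other_end:
  assumes "card e = 2" "v \<in> e"
  obtains y where "e = {v, y}" "y \<noteq> v"
  using assms by (metis card_2_iff insert_absorb2 insert_commute insert_iff singletonD)

text \<open>An end of a longest path has all its neighbours on the path.\<close>
lemma min_degree_2_cycle:
  assumes V: "finite V" "V \<noteq> {}" and F: "\<And>e. e \<in> F \<Longrightarrow> e \<subseteq> V \<and> card e = 2"
    and deg: "\<And>v. v \<in> V \<Longrightarrow> \<exists>e\<in>F. \<exists>e'\<in>F. e \<noteq> e' \<and> v \<in> e \<and> v \<in> e'"
  shows "\<not> acyclic_edges F"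
proof -
  define path where "path q \<longleftrightarrow> q \<noteq> [] \<and> distinct q \<and> set q \<subseteq> V \<and> walk F q" for q
  obtain v0 where "v0 \<in> V" using V by auto
  then have "path [v0]" by (simp add: path_def)
  moreover have "\<forall>q. path q \<longrightarrow> length q < Suc (card V)"
    using V(1) by (auto simp: path_def less_Suc_eq_le distinct_card[symmetric] intro: card_mono)
  ultimately obtain q where q: "path q" and max: "\<And>q'. path q' \<Longrightarrow> length q' \<le> length q"
    using Lattices_Big.ex_has_greatest_nat[of path "[v0]" length "Suc (card V)"] by blast
  obtain v r where vr: "q = v # r" using q by (cases q) (auto simp: path_def)
  have nb: "y \<in> set r" if "{v, y} \<in> F" "y \<noteq> v" for y
  proof (rule ccontr)
    assume "y \<notin> set r"
    moreover have "y \<in> V" using F[OF that(1)] by simp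
    ultimately have "path (y # q)"
      using q that unfolding path_def vr by (simp add: insert_commute)
    then show False using max by fastforce
  qed
  have "v \<in> V" using q vr by (simp add: path_def)
  then obtain e e' where e: "e \<in> F" "e' \<in> F" "e \<noteq> e'" "v \<in> e" "v \<in> e'"
    using deg[OF \<open>v \<in> V\<close>] by auto
  obtain y where y: "e = {v, y}" "y \<noteq> v" using other_end[of e v] F[OF e(1)] e(4) by blast
  obtain y' where y': "e' = {v, y'}" "y' \<noteq> v" using other_end[of e' v] F[OF e(2)] e(5) by blast
  have "y \<noteq> y'" using e y y' by auto
  \<comment> \<open>At least one of the two neighbours is not \<open>hd r\<close>; the edge to it
    skips a vertex of the path, so the cycle closed below has length at least three.\<close>
  then obtain z where z: "{v, z} \<in> F" "z \<noteq> v" "z \<noteq> hd r"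
    using e y y' by metis
  then obtain j where j: "j < length r" "r ! j = z" using nb by (metis in_set_conv_nth)
  have "j \<noteq> 0" using j z by (metis hd_conv_nth length_greater_0_conv)
  let ?c = "take (Suc j) r"
  have "last ?c = z" using j by (simp add: take_Suc_conv_app_nth)
  moreover have "walk F (v # ?c)"
    using q unfolding path_def vr by (auto simp: successively_conv_nth simp flip: take_Suc_Cons)
  moreover have "distinct (v # ?c)" using q unfolding path_def vr by (auto dest: in_set_takeD)
  ultimately have "is_cycle F (v # ?c)"
    using j \<open>j \<noteq> 0\<close> z(1) by (simp add: is_cycle_Cons insert_commute)
  then show ?thesis by (auto simp: acyclic_edges_def)
qed

text \<open>Induction on \<open>card V\<close>: \<open>min_degree_2_cycle\<close> supplies a vertex
  in at most one edge, and deleting it costs at most that edge. The bound \<open>card V\<close>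
  covers the empty vertex set too.\<close>

lemma acyclic_card_le:
  assumes "finite V" "\<And>e. e \<in> F \<Longrightarrow> e \<subseteq> V \<and> card e = 2" "acyclic_edges F"
  shows "card F \<le> card V"
  using assms
proof (induction "card V" arbitrary: V F)
  case 0
  then have "F = {}" by fastforce
  then show ?case by simp
next
  case (Suc n)
  then have "V \<noteq> {}" by auto
  then obtain v where v: "v \<in> V" and
    leaf: "\<And>e e'. e \<in> F \<Longrightarrow> e' \<in> F \<Longrightarrow> v \<in> e \<Longrightarrow> v \<in> e' \<Longrightarrow> e = e'"
    using min_degree_2_cycle[OF Suc.prems(1) \<open>V \<noteq> {}\<close> Suc.prems(2)] Suc.prems(3) by metis
  let ?F = "{e \<in> F. v \<notin> e}"
  have finF: "finite F"
    using Suc.prems by (intro finite_subset[of F "Pow V"]) auto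
  have "card ?F \<le> card (V - {v})"
  proof (rule Suc.hyps)
    show "n = card (V - {v})" using v Suc by simp
    show "acyclic_edges ?F" using Suc.prems(3) by (rule acyclic_edges_mono) auto
  qed (use Suc.prems in auto)
  moreover have "card {e \<in> F. v \<in> e} \<le> 1"
    using leaf by (intro card_le_Suc0_iff_eq[THEN iffD2, folded One_nat_def]) (use finF in auto)
  moreover have "card F \<le> card ?F + card {e \<in> F. v \<in> e}"
    by (rule order.trans[OF card_mono card_Un_le]) (use finF in auto)
  moreover have "card (V - {v}) = card V - 1" "card V > 0" using v Suc by auto
  ultimately show ?case by linarith
qed

text \<open>\<open>d\<close> is the number of items in each secretary problem. An edge has exactly
  one end in \<open>A\<close>, so the stars of \<open>A\<close> partition \<open>E\<close>. Degrees
  in \<open>B\<close> are controlled only during the construction below.\<close>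

locale star_graph =
  fixes A B :: "nat set" and E :: "edge set" and d :: nat
  assumes finite_parts: "finite A" "finite B" and disjoint_parts: "A \<inter> B = {}"
    and edges: "\<And>e. e \<in> E \<Longrightarrow> \<exists>a\<in>A. \<exists>b\<in>B. e = {a, b}"
    and star_card: "\<And>a. a \<in> A \<Longrightarrow> card {e \<in> E. a \<in> e} = d"
begin

abbreviation star :: "nat \<Rightarrow> edge set" where
  "star a \<equiv> {e \<in> E. a \<in> e}"

lemma finite_E: "finite E"
proof (rule finite_subset)
  show "E \<subseteq> (\<lambda>(a, b). {a, b}) ` (A \<times> B)" using edges by fastforce
qed (use finite_parts in auto)

lemma edge_cases:
  assumes "e \<in> E"
  obtains a b where "a \<in> A" "b \<in> B" "e = {a, b}" "a \<noteq> b"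
  using edges[OF assms] disjoint_parts by blast

lemma edge_props:
  assumes "e \<in> E"
  shows "e \<subseteq> A \<union> B" "card e = 2"
  using assms by (auto elim!: edge_cases)

lemma edge_star_unique:
  assumes "e \<in> E"
  shows "\<exists>!a. a \<in> A \<and> a \<in> e"
  using assms disjoint_parts by (elim edge_cases) auto

lemma simple_graph_E: "simple_graph E"
  using finite_E edge_props by (auto simp: simple_graph_def)

lemma card_eq_sum_A:
  assumes "F \<subseteq> E"
  shows "card F = (\<Sum>a\<in>A. card {e \<in> F. a \<in> e})"
proof -
  have "F = (\<Union>a\<in>A. {e \<in> F. a \<in> e})" using assms edges by blast
  moreover have "card (\<Union>a\<in>A. {e \<in> F. a \<in> e}) = (\<Sum>a\<in>A. card {e \<in> F. a \<in> e})"
  proof (rule card_UN_disjoint)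
    show "\<forall>a\<in>A. finite {e \<in> F. a \<in> e}"
      using finite_subset[OF assms finite_E] by auto
    show "\<forall>a\<in>A. \<forall>a'\<in>A. a \<noteq> a' \<longrightarrow> {e \<in> F. a \<in> e} \<inter> {e \<in> F. a' \<in> e} = {}"
      using assms edge_star_unique by blast
  qed (rule finite_parts)
  ultimately show ?thesis by simp
qed

lemma card_E: "card E = d * card A"
  using card_eq_sum_A[of E] star_card by simp

lemma sum_degrees_B: "(\<Sum>b\<in>B. card {e \<in> E. b \<in> e}) = card E"
proof -
  have "E = (\<Union>b\<in>B. {e \<in> E. b \<in> e})" using edges by blast
  moreover have "card (\<Union>b\<in>B. {e \<in> E. b \<in> e}) = (\<Sum>b\<in>B. card {e \<in> E. b \<in> e})"
  proof (rule card_UN_disjoint)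
    have "b = b'" if "e \<in> E" "b \<in> e" "b' \<in> e" "b \<in> B" "b' \<in> B" for e b b'
      using that disjoint_parts by (auto elim!: edge_cases)
    then show "\<forall>b\<in>B. \<forall>b'\<in>B. b \<noteq> b' \<longrightarrow> {e \<in> E. b \<in> e} \<inter> {e \<in> E. b' \<in> e} = {}"
      by blast
  qed (use finite_E finite_parts in auto)
  ultimately show ?thesis by simp
qed

end

section \<open>Large girth\<close>

text \<open>The ball of radius \<open>r\<close> around \<open>u\<close>: \<open>length q\<close>
  counts vertices, so \<open>Suc r\<close> allows \<open>r\<close> edges.\<close>

definition reach :: "edge set \<Rightarrow> nat \<Rightarrow> nat \<Rightarrow> nat set" where
  "reach E r u = {w. \<exists>q. q \<noteq> [] \<and> hd q = u \<and> last q = w \<and> walk E q \<and> length q \<le> Suc r}"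

lemma reach_sym: "w \<in> reach E r u \<longleftrightarrow> u \<in> reach E r w"
proof -
  have "u \<in> reach E r w" if w: "w \<in> reach E r u" for u w
  proof -
    obtain q where "q \<noteq> []" "hd q = u" "last q = w" "walk E q" "length q \<le> Suc r"
      using w by (auto simp: reach_def)
    then have "rev q \<noteq> []" "hd (rev q) = w" "last (rev q) = u" "walk E (rev q)" "length (rev q) \<le> Suc r"
      by (auto simp: hd_rev last_rev insert_commute)
    then show ?thesis unfolding reach_def by blast
  qed
  then show ?thesis by blast
qed

lemma reach_refl: "u \<in> reach E r u"
  by (auto simp: reach_def intro!: exI[of _ "[u]"])

lemma reach_Suc_subset:
  "reach E (Suc r) u \<subseteq> insert u (\<Union>v\<in>{v. {u, v} \<in> E}. reach E r v)"
proof
  fix w assume "w \<in> reach E (Suc r) u"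
  then obtain q where q: "q \<noteq> []" "hd q = u" "last q = w" "walk E q" "length q \<le> Suc (Suc r)"
    by (auto simp: reach_def)
  show "w \<in> insert u (\<Union>v\<in>{v. {u, v} \<in> E}. reach E r v)"
  proof (cases "tl q = []")
    case True
    then have "w = u" using q by (cases q) auto
    then show ?thesis by simp
  next
    case False
    then obtain v q' where "q = u # v # q'" using q by (metis list.collapse)
    then have "{u, v} \<in> E" "w \<in> reach E r v"
      using q by (auto simp: reach_def intro!: exI[of _ "v # q'"])
    then show ?thesis by blast
  qed
qed

text \<open>A ball of radius \<open>Suc r\<close> is covered by its centre and the balls of radius
  \<open>r\<close> around at most \<open>D\<close> neighbours, and
  \<open>1 + D * (D + 1) ^ r \<le> (D + 1) ^ Suc r\<close>.\<close>

lemma reach_bound: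
  assumes "finite E" and deg: "\<And>u. card {e \<in> E. u \<in> e} \<le> D"
  shows "finite (reach E r u) \<and> card (reach E r u) \<le> (D + 1) ^ r"
proof (induction r arbitrary: u)
  case 0
  have "reach E 0 u = {u}"
    by (auto simp: reach_def length_Suc_conv le_Suc_eq intro!: exI[of _ "[u]"])
  then show ?case by simp
next
  case (Suc r)
  let ?N = "{v. {u, v} \<in> E}"
  have inj: "inj_on (\<lambda>v. {u, v}) ?N" by (auto simp: inj_on_def doubleton_eq_iff)
  have sub: "(\<lambda>v. {u, v}) ` ?N \<subseteq> {e \<in> E. u \<in> e}" by auto
  have fin: "finite ?N"
    by (rule finite_imageD[OF _ inj]) (rule finite_subset[OF sub], use assms in auto)
  have "card ?N \<le> D"
    using card_image[OF inj] card_mono[OF _ sub] deg[of u] assms(1) by simp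
  have "card (reach E (Suc r) u) \<le> card (insert u (\<Union>v\<in>?N. reach E r v))"
    by (intro card_mono reach_Suc_subset) (use fin Suc in auto)
  also have "\<dots> \<le> 1 + card (\<Union>v\<in>?N. reach E r v)"
    using fin Suc by (subst card_insert_if) auto
  also have "card (\<Union>v\<in>?N. reach E r v) \<le> (\<Sum>v\<in>?N. card (reach E r v))"
    by (rule card_UN_le[OF fin])
  also have "\<dots> \<le> card ?N * (D + 1) ^ r"
    using sum_bounded_above[of ?N "\<lambda>v. card (reach E r v)" "(D + 1) ^ r"] Suc by simp
  also have "\<dots> \<le> D * (D + 1) ^ r" using \<open>card ?N \<le> D\<close> by simp
  finally have "card (reach E (Suc r) u) \<le> 1 + D * (D + 1) ^ r" by simp
  also have "\<dots> \<le> (D + 1) ^ Suc r" by simp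
  finally have "card (reach E (Suc r) u) \<le> (D + 1) ^ Suc r" .
  moreover have "finite (reach E (Suc r) u)"
    by (rule finite_subset[OF reach_Suc_subset]) (use fin Suc in auto)
  ultimately show ?case by (intro conjI)
qed

text \<open>Greedy choice: each chosen point rules out at most \<open>C\<close> points of
  \<open>L\<close>, itself included by reflexivity, so the size of \<open>L\<close> always leaves
  another one.\<close>

lemma ex_far_apart_subset:
  assumes fin: "finite L" and refl: "\<And>x. near x x" and sym: "\<And>x y. near x y \<Longrightarrow> near y x"
    and C: "\<And>x. card {y \<in> L. near x y} \<le> C" and L: "d * C < card L"
  shows "\<exists>T\<subseteq>L. card T = d \<and> (\<forall>x\<in>T. \<forall>y\<in>T. x \<noteq> y \<longrightarrow> \<not> near x y)"
  using L
proof (induction d)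
  case 0
  then show ?case by (intro exI[of _ "{}"]) auto
next
  case (Suc d)
  then obtain T where T: "T \<subseteq> L" "card T = d" "\<forall>x\<in>T. \<forall>y\<in>T. x \<noteq> y \<longrightarrow> \<not> near x y"
    by (metis add_lessD1 add.commute mult_Suc)
  have finT: "finite T" using T fin finite_subset by blast
  let ?U = "\<Union>x\<in>T. {y \<in> L. near x y}"
  have "card ?U \<le> (\<Sum>x\<in>T. card {y \<in> L. near x y})" by (rule card_UN_le[OF finT])
  also have "\<dots> \<le> d * C" using sum_bounded_above[of T "\<lambda>x. card {y \<in> L. near x y}" C] C T by simp
  also have "\<dots> < card L" using Suc.prems by simp
  finally have less: "card ?U < card L" .
  have "finite ?U" using finT fin by simp
  then have "\<not> L \<subseteq> ?U" using card_mono[of ?U L] less by linarith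
  then obtain y where y: "y \<in> L" "\<And>x. x \<in> T \<Longrightarrow> \<not> near x y" by blast
  have "y \<notin> T" using y refl by blast
  then have "card (insert y T) = Suc d" using finT T by simp
  moreover have "\<forall>x\<in>insert y T. \<forall>z\<in>insert y T. x \<noteq> z \<longrightarrow> \<not> near x z"
  proof (intro ballI impI notI)
    fix x z assume "x \<in> insert y T" "z \<in> insert y T" "x \<noteq> z" "near x z"
    then show False using T(3) y(2) sym[of x z] by auto
  qed
  moreover have "insert y T \<subseteq> L" using T(1) y(1) by simp
  ultimately show ?case by (intro exI[of _ "insert y T"] conjI)
qed

definition cycles_at_least :: "edge set \<Rightarrow> nat \<Rightarrow> bool" where
  "cycles_at_least E g \<longleftrightarrow> (\<forall>vs. is_cycle E vs \<longrightarrow> g \<le> length vs)"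

text \<open>A cycle through \<open>a\<close> enters and leaves by two different vertices of
  \<open>T\<close>; the rest of it is a walk of the old graph between them, with more than
  \<open>Suc g\<close> vertices since they are far apart. Cycles avoiding \<open>a\<close> are
  old.\<close>

lemma (in star_graph) add_vertex:
  assumes a: "a \<notin> A" "a \<notin> B" and T: "T \<subseteq> B" "card T = d"
    and far: "\<forall>x\<in>T. \<forall>y\<in>T. x \<noteq> y \<longrightarrow> y \<notin> reach E g x"
    and g: "cycles_at_least E g"
  defines "E' \<equiv> E \<union> (\<lambda>b. {a, b}) ` T"
  shows "star_graph (insert a A) B E' d" "cycles_at_least E' g"
    and "\<And>b. b \<in> B \<Longrightarrow>
           card {e \<in> E'. b \<in> e} = card {e \<in> E. b \<in> e} + (if b \<in> T then 1 else 0)"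
proof -
  have aE: "a \<notin> e" if "e \<in> E" for e using edge_props(1)[OF that] a by blast
  have aT: "a \<notin> T" using a T by blast
  have inj: "inj_on (\<lambda>b. {a, b}) T" by (auto simp: inj_on_def doubleton_eq_iff)
  show "star_graph (insert a A) B E' d"
  proof
    show "finite (insert a A)" "finite B" "insert a A \<inter> B = {}"
      using finite_parts disjoint_parts a by auto
    show "\<exists>a'\<in>insert a A. \<exists>b\<in>B. e = {a', b}" if "e \<in> E'" for e
      using that T edges unfolding E'_def by blast
    show "card {e \<in> E'. a' \<in> e} = d" if "a' \<in> insert a A" for a'
    proof (cases "a' = a")
      case True
      then have "{e \<in> E'. a' \<in> e} = (\<lambda>b. {a, b}) ` T" using aE by (auto simp: E'_def)
      then show ?thesis using card_image[OF inj] T by simp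
    next
      case False
      then have "a' \<in> A" using that by simp
      then have "a' \<notin> T" using T disjoint_parts by blast
      then have "{e \<in> E'. a' \<in> e} = {e \<in> E. a' \<in> e}" using False by (auto simp: E'_def)
      then show ?thesis using star_card[OF \<open>a' \<in> A\<close>] by simp
    qed
  qed
  show "card {e \<in> E'. b \<in> e} = card {e \<in> E. b \<in> e} + (if b \<in> T then 1 else 0)" if "b \<in> B" for b
  proof (cases "b \<in> T")
    case True
    then have "{e \<in> E'. b \<in> e} = insert {a, b} {e \<in> E. b \<in> e}"
      using that a by (auto simp: E'_def)
    moreover have "{a, b} \<notin> E" using aE by blast
    ultimately show ?thesis using True finite_E by simp
  next
    case False
    then have "{e \<in> E'. b \<in> e} = {e \<in> E. b \<in> e}" using that a by (auto simp: E'_def)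
    then show ?thesis using False by simp
  qed
  show "cycles_at_least E' g"
    unfolding cycles_at_least_def
  proof (intro allI impI)
    fix vs assume vs: "is_cycle E' vs"
    have E'E: "e \<in> E" if "e \<in> E'" "a \<notin> e" for e using that by (auto simp: E'_def)
    have E'T: "b \<in> T" if "{a, b} \<in> E'" for b
      using that aE aT by (auto simp: E'_def doubleton_eq_iff)
    show "g \<le> length vs"
    proof (cases "a \<in> set vs")
      case True
      obtain q where q: "is_cycle E' (a # q)" "length (a # q) = length vs"
        by (rule cycle_start_at[OF vs True])
      then have l: "2 \<le> length q" and dist: "distinct (a # q)" and w: "walk E' (a # q)"
        and last: "{last q, a} \<in> E'" by (auto simp: is_cycle_Cons)
      have q0: "q \<noteq> []" using l by auto
      have "hd q \<in> T" using E'T w q0 by (auto simp: successively_Cons)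
      moreover have "last q \<in> T" using E'T last by (simp add: insert_commute)
      moreover have "hd q \<noteq> last q"
      proof -
        obtain x y r where "q = x # y # r" using l by (metis Suc_le_length_iff numeral_2_eq_2)
        then show ?thesis using dist by (metis distinct.simps(2) last_ConsR last_in_set list.distinct(1) list.sel(1))
      qed
      ultimately have "last q \<notin> reach E g (hd q)" using far by blast
      moreover have "walk E q"
      proof (rule successively_mono)
        show "walk E' q" using w by (cases q) auto
        show "{x, y} \<in> E" if "x \<in> set q" "y \<in> set q" "{x, y} \<in> E'" for x y
          using that dist by (intro E'E) auto
      qed
      ultimately have "\<not> length q \<le> Suc g" using q0 by (auto simp: reach_def)
      then show ?thesis using q(2) by simp
    next
      case False
      have "is_cycle E vs"
        unfolding is_cycle_def
      proof (intro conjI allI impI)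
        fix i assume i: "i < length vs"
        then have "(i + 1) mod length vs < length vs" by (intro mod_less_divisor) linarith
        then have "vs ! i \<noteq> a" "vs ! ((i + 1) mod length vs) \<noteq> a"
          using i False nth_mem by metis+
        then show "{vs ! i, vs ! ((i + 1) mod length vs)} \<in> E"
          using vs i by (intro E'E) (auto simp: is_cycle_def)
      qed (use vs in \<open>auto simp: is_cycle_def\<close>)
      then show ?thesis using g by (simp add: cycles_at_least_def)
    qed
  qed
qed

text \<open>Greedy step: double counting leaves more than half of \<open>B\<close> with degree below \<open>2 d Q\<close>,
  and balls of bounded radius are small compared to that.\<close>
lemma star_graph_greedy:
  fixes Q g d :: nat
  assumes Q: "0 < Q" and d: "0 < d"
  defines "\<Delta> \<equiv> 2 * d * Q"
  assumes n: "2 * d * (\<Delta> + d + 1) ^ g < n"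
  shows "m \<le> Q * n \<Longrightarrow> \<exists>A E. star_graph A {0..<n} E d \<and> card A = m \<and> cycles_at_least E g \<and>
           (\<forall>b<n. card {e \<in> E. b \<in> e} \<le> \<Delta>)"
proof (induction m)
  case 0
  have sg: "star_graph {} {0..<n} {} d" by unfold_locales auto
  have "\<not> is_cycle {} vs" for vs by (auto simp: is_cycle_def intro!: exI[of _ 0])
  then have "cycles_at_least {} g" by (simp add: cycles_at_least_def)
  with sg show ?case by (intro exI[of _ "{}"]) auto
next
  case (Suc m)
  then obtain A E where sg: "star_graph A {0..<n} E d" and m: "card A = m"
    and g: "cycles_at_least E g" and deg: "\<forall>b<n. card {e \<in> E. b \<in> e} \<le> \<Delta>"
    by auto
  interpret star_graph A "{0..<n}" E d by (rule sg)
  \<comment> \<open>\<open>\<Delta>\<close> bounds the degrees in \<open>B\<close> and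
    \<open>d\<close> those in \<open>A\<close>, so their sum serves every vertex in the ball
    estimate.\<close>
  have D: "card {e \<in> E. u \<in> e} \<le> \<Delta> + d" for u
  proof -
    consider "u \<in> A" | "u < n" | "u \<notin> A \<union> {0..<n}" by auto
    then show ?thesis
    proof cases
      case 1
      then show ?thesis using star_card by simp
    next
      case 2
      then show ?thesis using deg by (simp add: trans_le_add1)
    next
      case 3
      then have "{e \<in> E. u \<in> e} = {}" using edge_props(1) by blast
      then show ?thesis by (simp only: card.empty)
    qed
  qed
  define L where "L = {b \<in> {0..<n}. card {e \<in> E. b \<in> e} < \<Delta>}"
  have "\<Delta> * card ({0..<n} - L) = (\<Sum>b\<in>{0..<n} - L. \<Delta>)" by simp
  also have "\<dots> \<le> (\<Sum>b\<in>{0..<n} - L. card {e \<in> E. b \<in> e})"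
    by (rule sum_mono) (auto simp: L_def)
  also have "\<dots> \<le> (\<Sum>b\<in>{0..<n}. card {e \<in> E. b \<in> e})"
    by (rule sum_mono2) auto
  also have "\<dots> = d * m" using sum_degrees_B card_E m by simp
  also have "\<dots> < d * (Q * n)" using Suc.prems d by simp
  finally have "d * Q * (2 * card ({0..<n} - L)) < d * Q * n" by (simp add: \<Delta>_def mult_ac)
  then have "2 * card ({0..<n} - L) < n" by simp
  moreover have "card ({0..<n} - L) + card L = n"
  proof -
    have "L \<subseteq> {0..<n}" by (auto simp: L_def)
    then show ?thesis using card_Diff_subset[of L "{0..<n}"] card_mono[of "{0..<n}" L]
      by (simp add: finite_subset)
  qed
  ultimately have L: "d * (\<Delta> + d + 1) ^ g < card L" using n by simp
  have C: "card {y \<in> L. y \<in> reach E g x} \<le> (\<Delta> + d + 1) ^ g" for x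
  proof -
    have "card {y \<in> L. y \<in> reach E g x} \<le> card (reach E g x)"
      using reach_bound[OF finite_E D] by (intro card_mono) auto
    then show ?thesis using reach_bound[OF finite_E D, of g x] by linarith
  qed
  have "\<exists>T\<subseteq>L. card T = d \<and> (\<forall>x\<in>T. \<forall>y\<in>T. x \<noteq> y \<longrightarrow> y \<notin> reach E g x)"
    by (rule ex_far_apart_subset[OF _ reach_refl iffD1[OF reach_sym] C L]) (simp add: L_def)
  then obtain T where T: "T \<subseteq> L" "card T = d"
      "\<forall>x\<in>T. \<forall>y\<in>T. x \<noteq> y \<longrightarrow> y \<notin> reach E g x" by blast
  have "finite (A \<union> {0..<n})" using finite_parts by simp
  then obtain a where a: "a \<notin> A" "a \<notin> {0..<n}" using ex_new_if_finite[OF infinite_UNIV_nat] by blast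
  have TB: "T \<subseteq> {0..<n}" using T(1) by (auto simp: L_def)
  note new = add_vertex[OF a TB T(2,3) g]
  have "card {e \<in> E \<union> (\<lambda>b. {a, b}) ` T. b \<in> e} \<le> \<Delta>" if "b < n" for b
    using new(3)[of b] that deg T(1) by (auto simp: L_def)
  moreover have "card (insert a A) = Suc m" using a finite_parts m by simp
  ultimately show ?case using new(1,2) by blast
qed

lemma ex_star_graph:
  fixes Q g d :: nat
  assumes "0 < Q" "0 < d"
  shows "\<exists>A B E. star_graph A B E d \<and> cycles_at_least E g \<and> B \<noteq> {} \<and> Q * card B \<le> card A"
proof -
  define n where "n = Suc (2 * d * (2 * d * Q + d + 1) ^ g)"
  have "2 * d * (2 * d * Q + d + 1) ^ g < n" by (simp add: n_def)
  from star_graph_greedy[OF assms this order_refl] obtain A E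
    where "star_graph A {0..<n} E d" "card A = Q * n" "cycles_at_least E g" by blast
  then show ?thesis
    by (intro exI[of _ A] exI[of _ "{0..<n}"] exI[of _ E]) (simp add: n_def)
qed

section \<open>The secretary problem in one star\<close>

text \<open>Absorbs the cycle test into the probability, so that one step of \<open>exp_gain\<close>
  is a plain convex combination (\<open>exp_gain_Cons\<close>).\<close>

definition acc_prob :: "policy \<Rightarrow> history \<Rightarrow> edge \<Rightarrow> real \<Rightarrow> real" where
  "acc_prob p h e x = (if acyclic_edges (insert e (accepted h)) then p h e x else 0)"

lemma acc_prob_bounds:
  assumes "valid_policy p"
  shows "0 \<le> acc_prob p h e x" "acc_prob p h e x \<le> 1"
  using assms by (auto simp: acc_prob_def valid_policy_def)

lemma exp_gain_Cons:
  "exp_gain p w h (e # es) =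
     acc_prob p h e (w e) * (w e + exp_gain p w (h @ [(e, w e, True)]) es)
     + (1 - acc_prob p h e (w e)) * exp_gain p w (h @ [(e, w e, False)]) es"
  by (simp add: acc_prob_def)

text \<open>Pays \<open>c e\<close> for the first accepted edge \<open>e\<close> of \<open>S\<close>
  and stops there; edges outside \<open>S\<close> still drive the history. The reward
  \<open>c\<close> is separate from the weights \<open>w\<close> that the policy sees, so it can be
  exchanged for \<open>win\<close> without altering any decision.\<close>

fun first_gain :: "policy \<Rightarrow> weight \<Rightarrow> edge set \<Rightarrow> (edge \<Rightarrow> real) \<Rightarrow> history \<Rightarrow> edge list \<Rightarrow> real"
where
  "first_gain p w S c h [] = 0"
| "first_gain p w S c h (e # es) =
     acc_prob p h e (w e) * (if e \<in> S then c e else first_gain p w S c (h @ [(e, w e, True)]) es)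
     + (1 - acc_prob p h e (w e)) * first_gain p w S c (h @ [(e, w e, False)]) es"

lemma convex_comb_mono:
  fixes q :: real
  assumes "0 \<le> q" "q \<le> 1" "a \<le> a'" "b \<le> b'"
  shows "q * a + (1 - q) * b \<le> q * a' + (1 - q) * b'"
  using assms by (intro add_mono mult_left_mono) auto

lemma convex_comb_le:
  fixes q :: real
  assumes "0 \<le> q" "q \<le> 1" "a \<le> c" "b \<le> c"
  shows "q * a + (1 - q) * b \<le> c"
  using convex_comb_mono[OF assms] by (simp add: algebra_simps)

text \<open>At most one reward is ever paid, so a pointwise error of \<delta> costs \<delta> in
  total, not once per edge.\<close>

lemma first_gain_le_add:
  assumes p: "valid_policy p" and c: "\<And>e. e \<in> S \<Longrightarrow> c e \<le> c' e + \<delta>" and "0 \<le> \<delta>"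
  shows "first_gain p w S c h es \<le> first_gain p w S c' h es + \<delta>"
proof (induction es arbitrary: h)
  case Nil
  then show ?case using assms by simp
next
  case (Cons e es)
  let ?q = "acc_prob p h e (w e)"
  have "first_gain p w S c h (e # es) \<le>
    ?q * ((if e \<in> S then c' e else first_gain p w S c' (h @ [(e, w e, True)]) es) + \<delta>) +
    (1 - ?q) * (first_gain p w S c' (h @ [(e, w e, False)]) es + \<delta>)"
    unfolding first_gain.simps
    by (intro convex_comb_mono acc_prob_bounds p) (use c Cons.IH in auto)
  also have "\<dots> = first_gain p w S c' h (e # es) + \<delta>"
    by (simp add: algebra_simps)
  finally show ?case .
qed

lemma first_gain_scale: "first_gain p w S (\<lambda>e. r * c e) h es = r * first_gain p w S c h es"
  by (induction es arbitrary: h) (auto simp: algebra_simps)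

text \<open>\<open>x\<close> holds the levels already revealed, \<open>es\<close> lists the edges
  still to be revealed. Summing in arrival order lets a decision be pulled out of the sums over
  later levels.\<close>

primrec level_sum :: "nat \<Rightarrow> 'e list \<Rightarrow> (('e \<Rightarrow> nat) \<Rightarrow> real) \<Rightarrow> ('e \<Rightarrow> nat) \<Rightarrow> real" where
  "level_sum N [] F x = F x"
| "level_sum N (e # es) F x = (\<Sum>v\<in>{1..N}. level_sum N es F (x(e := v)))"

lemma level_sum_cong:
  assumes "\<And>y. (\<And>e. e \<notin> set es \<Longrightarrow> y e = x e) \<Longrightarrow> F y = F' y"
  shows "level_sum N es F x = level_sum N es F' x"
  using assms
proof (induction es arbitrary: x)
  case (Cons e es)
  have "level_sum N es F (x(e := v)) = level_sum N es F' (x(e := v))" for v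
  proof (rule Cons.IH)
    fix y assume "\<And>a. a \<notin> set es \<Longrightarrow> y a = (x(e := v)) a"
    then show "F y = F' y"
      by (intro Cons.prems) auto
  qed
  then show ?case by simp
qed auto

lemma level_sum_linear: "level_sum N es (\<lambda>y. a * F y + b * F' y) x = a * level_sum N es F x + b * level_sum N es F' x"
  by (induction es arbitrary: x) (auto simp: sum.distrib sum_distrib_left)

lemma level_sum_0: "level_sum N es (\<lambda>_. 0) x = 0"
  by (induction es arbitrary: x) auto

lemma level_sum_eq_0:
  assumes "\<And>y. (\<And>e. e \<notin> set es \<Longrightarrow> y e = x e) \<Longrightarrow> F y = 0"
  shows "level_sum N es F x = 0"
  using level_sum_cong[of es x F "\<lambda>_. 0" N] assms by (simp add: level_sum_0)

text \<open>Mass of an injective sequence of \<open>k\<close> levels with maximum \<open>m\<close>. For \<open>0 < k < m\<close> it is consistent: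
  \<open>seq_mass k m = (m - k) * seq_mass (k + 1) m + (\<Sum>v>m. seq_mass (k + 1) v)\<close>.\<close>
definition seq_mass :: "nat \<Rightarrow> nat \<Rightarrow> real" where
  "seq_mass k m = fact (m - k) / (real k * fact m)"

lemma seq_mass_nonneg: "0 \<le> seq_mass k m"
  by (simp add: seq_mass_def)

text \<open>There are \<open>m - k\<close> free levels below the maximum. Extensions by one of them
  carry the share \<open>k / (k + 1)\<close>, the probability that item \<open>k + 1\<close> of a
  random order is no record.\<close>

lemma seq_mass_step_eq:
  assumes "0 < k" "k < m"
  shows "real (m - k) * seq_mass (Suc k) m = real k / (real k + 1) * seq_mass k m"
proof -
  obtain j where j: "m - k = Suc j"
    using assms by (metis Suc_diff_Suc)
  then have j': "m - Suc k = j" by simp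
  have "real (m - k) * seq_mass (Suc k) m = real (Suc j) * fact j / (real (k + 1) * fact m)"
    by (simp add: seq_mass_def j j')
  also have "\<dots> = fact (Suc j) / (real (k + 1) * fact m)"
    by (subst fact_Suc) (rule refl)
  also have "\<dots> = real k / (real k + 1) * seq_mass k m"
    using assms by (simp add: seq_mass_def j del: fact_Suc)
  finally show ?thesis by (simp add: add.commute)
qed

lemma seq_mass_step_le:
  assumes "0 < k"
  shows "real (m - k) * seq_mass (Suc k) m \<le> real k / (real k + 1) * seq_mass k m"
  using seq_mass_step_eq[OF assms, of m] seq_mass_nonneg[of k m] by (cases "k < m") auto

text \<open>Up to the common factor, each term is a difference of consecutive values of
  \<open>fact (v - k) / fact v\<close>, so the sum telescopes. The value at \<open>m\<close> gives
  the share \<open>1 / (k + 1)\<close> of records; the value at \<open>N\<close> is what truncation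
  removes.\<close>

lemma seq_mass_tail_eq:
  assumes "0 < k" "k \<le> m" "m \<le> N"
  shows "(\<Sum>v\<in>{m<..N}. seq_mass (Suc k) v) =
    (fact (m - k) / fact m - fact (N - k) / fact N) / (real k * (real k + 1))"
  using \<open>m \<le> N\<close>
proof (induction N rule: dec_induct)
  case (step n)
  have "n \<ge> k" using step assms by simp
  then obtain j where j: "n = k + j" using le_Suc_ex by blast
  have "{m<..Suc n} = insert (Suc n) {m<..n}" using step by auto
  then have "(\<Sum>v\<in>{m<..Suc n}. seq_mass (Suc k) v) = seq_mass (Suc k) (Suc n) + (\<Sum>v\<in>{m<..n}. seq_mass (Suc k) v)"
    by simp
  also have "seq_mass (Suc k) (Suc n) = (fact (n - k) / fact n - fact (Suc n - k) / fact (Suc n)) / (real k * (real k + 1))"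
  proof -
    have F: "fact (Suc n) = real (n + 1) * fact n" "fact (Suc n - k) = real (j + 1) * fact j"
      by (simp_all add: j Suc_diff_le)
    have alg: "P / (A * (B * Q)) = (P / Q - C * P / (B * Q)) / (K * A)"
      if "A > 0" "B > 0" "Q > 0" "K > 0" "B = C + K" for P Q A B C K :: real
      using that by (simp add: divide_simps) (simp add: algebra_simps)
    have "seq_mass (Suc k) (Suc n) = fact j / (real (k + 1) * (real (n + 1) * fact n))"
      unfolding seq_mass_def F by (simp add: j)
    also have "\<dots> = (fact j / fact n - real (j + 1) * fact j / (real (n + 1) * fact n)) / (real k * real (k + 1))"
      by (rule alg) (use assms(1) in \<open>auto simp: j\<close>)
    finally show ?thesis
      unfolding F by (simp add: j add.commute)
  qed
  finally show ?case
    using step by (simp add: add_divide_distrib[symmetric] diff_divide_distrib[symmetric])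
qed auto

lemma seq_mass_tail_le:
  assumes "0 < k" "k \<le> m"
  shows "(\<Sum>v\<in>{m<..N}. seq_mass (Suc k) v) \<le> seq_mass k m / (real k + 1)"
proof (cases "m \<le> N")
  case True
  have "(\<Sum>v\<in>{m<..N}. seq_mass (Suc k) v) \<le> fact (m - k) / fact m / (real k * (real k + 1))"
    unfolding seq_mass_tail_eq[OF assms True] by (intro divide_right_mono) auto
  then show ?thesis by (simp add: seq_mass_def field_simps)
qed (auto simp: seq_mass_nonneg)

section \<open>Density and maximal edge within one star\<close>

definition dens :: "'e set \<Rightarrow> ('e \<Rightarrow> nat) \<Rightarrow> real" where
  "dens S x = (if inj_on x S then seq_mass (card S) (Max (x ` S)) else 0)"

definition win :: "'e set \<Rightarrow> ('e \<Rightarrow> nat) \<Rightarrow> 'e \<Rightarrow> real" where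
  "win S x e = (if x e = Max (x ` S) then 1 else 0)"

lemma dens_nonneg: "0 \<le> dens S x"
  by (simp add: dens_def seq_mass_nonneg)

lemma level_sum_dens_not_inj:
  assumes "\<not> inj_on x (S - set rs)"
  shows "level_sum N rs (\<lambda>y. dens S y * F y) x = 0"
proof (rule level_sum_eq_0)
  fix y assume y: "\<And>e. e \<notin> set rs \<Longrightarrow> y e = x e"
  have "\<not> inj_on y (S - set rs)"
    using assms y inj_on_cong[of "S - set rs" y x] by auto
  then have "\<not> inj_on y S" using inj_on_subset[of y S "S - set rs"] by blast
  then show "dens S y * F y = 0" by (simp add: dens_def)
qed

text \<open>If \<open>rs\<close> lists the edges of \<open>S\<close> still to come,
  \<open>S - set rs\<close> is the set of those seen; revealing \<open>e\<close> enlarges it by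
  one.\<close>

lemma Diff_set_Cons:
  assumes "e \<in> S" "e \<notin> set rs"
  shows "S - set rs = insert e (S - set (e # rs))"
  using assms by auto

lemma seen_update:
  assumes "e \<in> S" "e \<notin> set rs"
  shows "x(e := v) ` (S - set rs) = insert v (x ` (S - set (e # rs)))"
    and "inj_on (x(e := v)) (S - set rs) \<longleftrightarrow>
           inj_on x (S - set (e # rs)) \<and> v \<notin> x ` (S - set (e # rs))"
proof -
  have 1: "x(e := v) ` (S - set (e # rs)) = x ` (S - set (e # rs))"
    by (intro image_cong) auto
  have 2: "inj_on (x(e := v)) (S - set (e # rs)) = inj_on x (S - set (e # rs))"
    by (intro inj_on_cong) auto
  show "x(e := v) ` (S - set rs) = insert v (x ` (S - set (e # rs)))"
    unfolding Diff_set_Cons[OF assms] image_insert 1 by simp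
  show "inj_on (x(e := v)) (S - set rs) \<longleftrightarrow>
           inj_on x (S - set (e # rs)) \<and> v \<notin> x ` (S - set (e # rs))"
    unfolding Diff_set_Cons[OF assms] inj_on_insert 2
    using 1 by auto
qed

lemma card_seen_Cons:
  assumes "finite S" "e \<in> S" "e \<notin> set rs"
  shows "card (S - set rs) = Suc (card (S - set (e # rs)))"
  unfolding Diff_set_Cons[OF assms(2,3)] using assms by simp

section \<open>Winning mass of a record, and backward induction over the arrivals\<close>

lemma step_ratio: "real (Suc k) / d * (real k / (real k + 1) * g) = real k / d * g"
proof -
  have "a / d * (b / a * g) = b / d * g" if "a \<noteq> 0" for a b :: real
    using that by simp
  from this[of "real (Suc k)" "real k"] show ?thesis by (simp add: add.commute)
qed

text \<open>\<open>e\<close> is the maximum of the seen edges, \<open>k\<close> in number. Each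
  arrival leaves it the maximum with share \<open>k / (k + 1)\<close>, and the product of these
  shares up to \<open>card S\<close> telescopes to \<open>k / card S\<close>. Equality needs room:
  \<open>card S \<le> x e\<close> for enough distinct levels, and \<open>x e \<le> N\<close> so that
  all levels below \<open>x e\<close> are in range.\<close>

lemma level_sum_win_aux:
  assumes "finite S" "distinct rs" "set rs \<subseteq> S" "e \<in> S - set rs"
    and "inj_on x (S - set rs)" "x ` (S - set rs) \<subseteq> {1..x e}"
  shows "level_sum N rs (\<lambda>y. dens S y * win S y e) x \<le>
           real (card (S - set rs)) / card S * seq_mass (card (S - set rs)) (x e) \<and>
         (card S \<le> x e \<and> x e \<le> N \<longrightarrow> level_sum N rs (\<lambda>y. dens S y * win S y e) x =
           real (card (S - set rs)) / card S * seq_mass (card (S - set rs)) (x e))"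
  using assms(2-)
proof (induction rs arbitrary: x)
  case Nil
  then have "Max (x ` S) = x e"
    using assms(1) by (intro Max_eqI) auto
  moreover have "card S \<noteq> 0" using Nil assms(1) by auto
  ultimately show ?case
    using Nil by (auto simp: dens_def win_def)
next
  case (Cons b rs)
  let ?T = "x ` (S - set (b # rs))" and ?k = "card (S - set (b # rs))" and ?d = "card S"
  let ?L = "\<lambda>v. level_sum N rs (\<lambda>y. dens S y * win S y e) (x(b := v))"
  have b: "b \<in> S" "b \<notin> set rs" "b \<noteq> e" and e: "e \<in> S" "e \<notin> set rs"
    using Cons.prems by auto
  have k1: "card (S - set rs) = Suc ?k"
    by (rule card_seen_Cons) (use assms(1) b in auto)
  have kT: "card ?T = ?k" using Cons.prems by (intro card_image) auto
  have "{e} \<subseteq> S - set (b # rs)" using Cons.prems by blast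
  from card_mono[OF _ this] assms(1) have k0: "0 < ?k" by simp
  have dk: "?k < ?d"
    using b assms(1) by (intro psubset_card_mono) auto
  have T: "?T \<subseteq> {1..x e}" using Cons.prems by blast
  define g where "g = real (Suc ?k) / ?d * seq_mass (Suc ?k) (x e)"
  \<comment> \<open>Repeated levels have density zero, levels above \<open>x e\<close> beat
    \<open>e\<close>, and every other free level contributes at most the same amount
    \<open>g\<close>.\<close>
  have bad: "?L v = 0" if "v \<in> ?T" for v
    using seen_update(2)[OF b(1,2), of x v] that by (intro level_sum_dens_not_inj) blast
  have big: "?L v = 0" if "v > x e" for v
  proof (rule level_sum_eq_0)
    fix y assume y: "\<And>a. a \<notin> set rs \<Longrightarrow> y a = (x(b := v)) a"
    have "y b = v" "y e = x e" using y b e by auto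
    moreover have "y b \<le> Max (y ` S)" using b assms(1) by simp
    ultimately show "dens S y * win S y e = 0" using that by (simp add: win_def)
  qed
  have good: "?L v \<le> g \<and> (?d \<le> x e \<and> x e \<le> N \<longrightarrow> ?L v = g)" if "v \<in> {1..x e} - ?T" for v
  proof -
    have "inj_on (x(b := v)) (S - set rs)"
      using seen_update(2)[OF b(1,2), of x v] that Cons.prems(4) by blast
    moreover have "x(b := v) ` (S - set rs) \<subseteq> {1..(x(b := v)) e}"
      using seen_update(1)[OF b(1,2), of x v] that T b(3) by auto
    moreover have "distinct rs" "set rs \<subseteq> S" "e \<in> S - set rs"
      using Cons.prems by auto
    ultimately have "?L v \<le> real (card (S - set rs)) / ?d * seq_mass (card (S - set rs)) ((x(b := v)) e) \<and>
        (?d \<le> (x(b := v)) e \<and> (x(b := v)) e \<le> N \<longrightarrow>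
         ?L v = real (card (S - set rs)) / ?d * seq_mass (card (S - set rs)) ((x(b := v)) e))"
      by (intro Cons.IH)
    moreover have "(x(b := v)) e = x e" using b(3) by simp
    ultimately show ?thesis unfolding k1 g_def by simp
  qed
  have fin: "finite ?T" using assms(1) by auto
  have cardT: "card ({1..x e} - ?T) = x e - ?k"
    using card_Diff_subset[OF fin T] kT by simp
  let ?U = "{1..N} \<inter> ({1..x e} - ?T)"
  have eq: "level_sum N (b # rs) (\<lambda>y. dens S y * win S y e) x = sum ?L ?U"
    unfolding level_sum.simps
  proof (rule sum.mono_neutral_right)
    show "\<forall>v\<in>{1..N} - ?U. ?L v = 0"
    proof
      fix v assume v: "v \<in> {1..N} - ?U"
      show "?L v = 0"
      proof (cases "v \<in> ?T")
        case False
        then have "v > x e" using v by auto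
        then show ?thesis by (rule big)
      qed (rule bad)
    qed
  qed auto
  have g0: "0 \<le> g" by (simp add: g_def seq_mass_nonneg)
  have gk: "real (x e - ?k) * g = real (Suc ?k) / ?d * (real (x e - ?k) * seq_mass (Suc ?k) (x e))"
    by (simp add: g_def)
  have "sum ?L ?U \<le> (\<Sum>v\<in>?U. g)"
    by (rule sum_mono) (use good in auto)
  also have "\<dots> \<le> (\<Sum>v\<in>{1..x e} - ?T. g)"
    by (rule sum_mono2) (use g0 in auto)
  also have "\<dots> = real (x e - ?k) * g" by (simp only: sum_constant cardT)
  also have "\<dots> \<le> real (Suc ?k) / ?d * (real ?k / (real ?k + 1) * seq_mass ?k (x e))"
    unfolding gk by (intro mult_left_mono seq_mass_step_le k0) auto
  also have "\<dots> = real ?k / ?d * seq_mass ?k (x e)" by (rule step_ratio)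
  finally have le: "sum ?L ?U \<le> real ?k / ?d * seq_mass ?k (x e)" .
  have "sum ?L ?U = real ?k / ?d * seq_mass ?k (x e)" if "?d \<le> x e" "x e \<le> N"
  proof -
    have "?U = {1..x e} - ?T" using that by auto
    then have "sum ?L ?U = (\<Sum>v\<in>{1..x e} - ?T. g)"
      using good that by (intro sum.cong) auto
    also have "\<dots> = real (x e - ?k) * g" by (simp only: sum_constant cardT)
    also have "\<dots> = real (Suc ?k) / ?d * (real ?k / (real ?k + 1) * seq_mass ?k (x e))"
      unfolding gk using dk that k0 by (subst seq_mass_step_eq) auto
    also have "\<dots> = real ?k / ?d * seq_mass ?k (x e)" by (rule step_ratio)
    finally show ?thesis .
  qed
  then show ?case using eq le by simp
qed

lemmas level_sum_win_le = level_sum_win_aux[THEN conjunct1]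
lemmas level_sum_win_eq = level_sum_win_aux[THEN conjunct2, rule_format]


text \<open>The acceptance probability depends on the history and on the level \<open>v\<close> just
  revealed, not on the levels still summed over, so it factors out. Acceptance ends the game with
  reward \<open>win S y e\<close>.\<close>

lemma level_sum_first_gain_step:
  assumes "e \<in> S" "e \<notin> set rs"
  shows "level_sum N rs (\<lambda>y. dens S y * first_gain p (\<omega> \<circ> y) S (win S y) h (e # es)) (x(e := v)) =
     acc_prob p h e (\<omega> v) * level_sum N rs (\<lambda>y. dens S y * win S y e) (x(e := v))
     + (1 - acc_prob p h e (\<omega> v)) *
       level_sum N rs (\<lambda>y. dens S y * first_gain p (\<omega> \<circ> y) S (win S y) (h @ [(e, \<omega> v, False)]) es) (x(e := v))"
    (is "?l = _")
proof -
  let ?q = "acc_prob p h e (\<omega> v)"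
  have "?l = level_sum N rs (\<lambda>y. ?q * (dens S y * win S y e) + (1 - ?q) *
     (dens S y * first_gain p (\<omega> \<circ> y) S (win S y) (h @ [(e, \<omega> v, False)]) es)) (x(e := v))"
  proof (rule level_sum_cong)
    fix y assume "\<And>a. a \<notin> set rs \<Longrightarrow> y a = (x(e := v)) a"
    then have "y e = v" using assms by auto
    then show "dens S y * first_gain p (\<omega> \<circ> y) S (win S y) h (e # es) =
      ?q * (dens S y * win S y e) + (1 - ?q) *
     (dens S y * first_gain p (\<omega> \<circ> y) S (win S y) (h @ [(e, \<omega> v, False)]) es)"
      using assms by (simp add: algebra_simps)
  qed
  then show ?thesis by (simp only: level_sum_linear)
qed

text \<open>One Bellman step with \<open>a = u (Suc k)\<close> and \<open>b = u k\<close>: with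
  probability \<open>k / (k + 1)\<close> the next item is no record; a record is either taken, which
  wins with probability \<open>(k + 1) / d\<close>, or passed. The two hypotheses settle the two
  cases of \<open>max\<close>.\<close>

lemma value_step:
  fixes a b :: real
  assumes "a \<le> b" "1 / real d + real k / (real k + 1) * a \<le> b"
  shows "a * (real k / (real k + 1)) + max (real (Suc k) / real d) a / (real k + 1) \<le> b"
proof (cases "real (Suc k) / real d \<le> a")
  case True
  have "a * (real k / (real k + 1)) + a / (real k + 1) = a * (real k + 1) / (real k + 1)"
    by (simp only: times_divide_eq_right add_divide_distrib[symmetric] distrib_left mult_1_right)
  also have "\<dots> = a" by simp
  finally show ?thesis using True assms(1) by (simp add: max_absorb2)
next
  case False
  have "real (Suc k) / real d / (real k + 1) = 1 / real d"
    by (simp add: add.commute)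
  then show ?thesis using False assms(2) by (simp add: max_def mult.commute)
qed

text \<open>While nothing in \<open>S\<close> is accepted, \<open>u k\<close> bounds the conditional
  winning probability after \<open>k\<close> seen items whatever their levels, since these enter
  only through the factor \<open>seq_mass\<close>. The history \<open>h\<close> is arbitrary, which
  covers all that happens outside \<open>S\<close>. Before the first item there is no maximum, and
  the harmonic sum, the total of \<open>seq_mass 1\<close>, takes its place.\<close>

lemma level_sum_first_gain_le:
  fixes u :: "nat \<Rightarrow> real"
  defines "bound \<equiv> \<lambda>N S x A. if A = {} then u 1 * (\<Sum>v\<in>{1..N}. 1 / real v)
                 else u (card A) * seq_mass (card A) (Max (x ` A))"
  assumes p: "valid_policy p" and fin: "finite S"
    and u0: "\<And>k. 0 \<le> u k"
    and u1: "1 / card S \<le> u 1"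
    and u2: "\<And>k. 1 \<le> k \<Longrightarrow> k < card S \<Longrightarrow> u (Suc k) \<le> u k"
    and u3: "\<And>k. 1 \<le> k \<Longrightarrow> k < card S \<Longrightarrow> 1 / card S + real k / (real k + 1) * u (Suc k) \<le> u k"
    and es: "distinct es"
    and x: "inj_on x (S - set es)" "x ` (S - set es) \<subseteq> {1..N}"
  shows "level_sum N (filter (\<lambda>e. e \<in> S) es)
      (\<lambda>y. dens S y * first_gain p (\<omega> \<circ> y) S (win S y) h es) x \<le> bound N S x (S - set es)"
  using es x
proof (induction es arbitrary: h x)
  case Nil
  have "0 \<le> bound N S x S"
    unfolding bound_def using u0 by (auto intro!: mult_nonneg_nonneg sum_nonneg simp: seq_mass_nonneg)
  then show ?case by simp
next
  case (Cons e es)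
  show ?case
  proof (cases "e \<in> S")
    case False
    then have S: "S - set (e # es) = S - set es" by auto
    \<comment> \<open>The level of an edge outside \<open>S\<close> is fixed by \<open>x\<close>, so
      its arrival only mixes two histories, both covered by the induction hypothesis.\<close>
    define q where "q = acc_prob p h e (\<omega> (x e))"
    let ?rs = "filter (\<lambda>e. e \<in> S) es"
    let ?F = "\<lambda>b y. dens S y * first_gain p (\<omega> \<circ> y) S (win S y) (h @ [(e, \<omega> (x e), b)]) es"
    have "level_sum N ?rs (\<lambda>y. dens S y * first_gain p (\<omega> \<circ> y) S (win S y) h (e # es)) x =
       level_sum N ?rs (\<lambda>y. q * ?F True y + (1 - q) * ?F False y) x"
    proof (rule level_sum_cong)
      fix y assume "\<And>a. a \<notin> set ?rs \<Longrightarrow> y a = x a"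
      then have "y e = x e" using False by auto
      then show "dens S y * first_gain p (\<omega> \<circ> y) S (win S y) h (e # es) =
          q * ?F True y + (1 - q) * ?F False y"
        using False by (simp add: algebra_simps q_def)
    qed
    also have "\<dots> = q * level_sum N ?rs (?F True) x + (1 - q) * level_sum N ?rs (?F False) x"
      by (rule level_sum_linear)
    also have "\<dots> \<le> bound N S x (S - set es)"
      using Cons.prems unfolding S
      by (intro convex_comb_le Cons.IH) (auto simp: q_def acc_prob_bounds p)
    finally show ?thesis unfolding S using False by (simp only: filter.simps if_False)
  next
    case True
    let ?rs = "filter (\<lambda>e. e \<in> S) es"
    let ?A = "S - set (e # es)" and ?d = "card S"
    let ?k = "card ?A" and ?T = "x ` ?A"
    let ?W = "\<lambda>v. level_sum N ?rs (\<lambda>y. dens S y * win S y e) (x(e := v))"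
    let ?L = "\<lambda>v. level_sum N ?rs (\<lambda>y. dens S y *
        first_gain p (\<omega> \<circ> y) S (win S y) (h @ [(e, \<omega> v, False)]) es) (x(e := v))"
    let ?q = "\<lambda>v. acc_prob p h e (\<omega> v)"
    let ?D = "\<lambda>v. ?q v * ?W v + (1 - ?q v) * ?L v"
    note q = acc_prob_bounds[OF p]
    have e: "e \<notin> set es" using Cons.prems by auto
    have SF: "S - set ?rs = S - set es" by auto
    note upd = seen_update[OF True e]
    have cS: "card (S - set es) = Suc ?k" by (rule card_seen_Cons[OF fin True e])
    have Ad: "?k < ?d" using True fin by (intro psubset_card_mono) auto
    have finT: "finite ?T" using fin by auto
    have kT: "card ?T = ?k" using Cons.prems by (intro card_image) auto
    have step: "level_sum N (filter (\<lambda>e. e \<in> S) (e # es))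
      (\<lambda>y. dens S y * first_gain p (\<omega> \<circ> y) S (win S y) h (e # es)) x = (\<Sum>v\<in>{1..N}. ?D v)"
      using True e by (simp only: filter.simps level_sum.simps if_True)
         (intro sum.cong refl level_sum_first_gain_step, auto)
    have bad: "?D v = 0" if "v \<in> ?T" for v
    proof -
      have "\<not> inj_on (x(e := v)) (S - set ?rs)" using upd(2)[of x v] that unfolding SF by blast
      then show ?thesis by (simp add: level_sum_dens_not_inj)
    qed
    have L: "?L v \<le> u (Suc ?k) * seq_mass (Suc ?k) (Max (insert v ?T))" if "v \<in> {1..N}" "v \<notin> ?T" for v
    proof -
      have "?L v \<le> bound N S (x(e := v)) (S - set es)"
      proof (rule Cons.IH)
        show "inj_on (x(e := v)) (S - set es)"
          using upd(2)[of x v] that Cons.prems(2) by blast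
        show "x(e := v) ` (S - set es) \<subseteq> {1..N}"
          unfolding upd(1) by (intro insert_subsetI that Cons.prems(3))
      qed (use Cons.prems(1) in auto)
      moreover have "S - set es \<noteq> {}" using True e by blast
      ultimately show ?thesis unfolding bound_def upd(1) cS by simp
    qed
    have Wrec: "?W v \<le> real (Suc ?k) / ?d * seq_mass (Suc ?k) v" if "v \<in> {1..N}" "\<forall>t\<in>?T. t < v" for v
    proof -
      have "?W v \<le> real (card (S - set ?rs)) / ?d * seq_mass (card (S - set ?rs)) ((x(e := v)) e)"
      proof (rule level_sum_win_le)
        show "inj_on (x(e := v)) (S - set ?rs)"
          unfolding SF upd(2)
        proof (intro conjI Cons.prems(2) notI)
          assume "v \<in> ?T"
          from bspec[OF that(2) this] show False by simp
        qed
        show "x(e := v) ` (S - set ?rs) \<subseteq> {1..(x(e := v)) e}"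
        proof -
          have "x ` ?A \<subseteq> {1..v}"
          proof
            fix t assume t: "t \<in> x ` ?A"
            show "t \<in> {1..v}"
              using bspec[OF that(2) t] subsetD[OF Cons.prems(3) t] by simp
          qed
          then show ?thesis unfolding SF upd(1) using that(1) by simp
        qed
      qed (use fin e True Cons.prems in auto)
      then show ?thesis unfolding SF cS by simp
    qed
    have Drec: "?D v \<le> max (real (Suc ?k) / ?d) (u (Suc ?k)) * seq_mass (Suc ?k) v"
      if "v \<in> {1..N}" "\<forall>t\<in>?T. t < v" for v
    proof (intro convex_comb_le q)
      have "Max (insert v ?T) = v"
        using that finT by (intro Max_eqI) (auto intro: less_imp_le)
      moreover have vT: "v \<notin> ?T"
      proof
        assume "v \<in> ?T"
        from bspec[OF that(2) this] show False by simp
      qed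
      ultimately have "?L v \<le> u (Suc ?k) * seq_mass (Suc ?k) v" using L[OF that(1) vT] by simp
      also have "\<dots> \<le> max (real (Suc ?k) / ?d) (u (Suc ?k)) * seq_mass (Suc ?k) v"
        by (intro mult_right_mono seq_mass_nonneg) auto
      finally show "?L v \<le> \<dots>" .
      have "real (Suc ?k) / ?d * seq_mass (Suc ?k) v \<le> max (real (Suc ?k) / ?d) (u (Suc ?k)) * seq_mass (Suc ?k) v"
        by (intro mult_right_mono seq_mass_nonneg) auto
      then show "?W v \<le> \<dots>" using Wrec[OF that] by linarith
    qed
    have "(\<Sum>v\<in>{1..N}. ?D v) \<le> bound N S x ?A"
    proof (cases "?A = {}")
      case True
      then have k: "?k = 0" "?T = {}" by (simp_all only: card.empty image_empty)
      have "(\<Sum>v\<in>{1..N}. ?D v) \<le> (\<Sum>v\<in>{1..N}. u 1 * (1 / real v))"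
      proof (rule sum_mono)
        fix v assume v: "v \<in> {1..N}"
        have "?D v \<le> max (real (Suc ?k) / ?d) (u (Suc ?k)) * seq_mass (Suc ?k) v"
          by (rule Drec) (use v k(2) in auto)
        also have "\<dots> = max (1 / ?d) (u 1) * seq_mass 1 v" unfolding k by simp
        also have "max (1 / ?d) (u 1) = u 1" using u1 by simp
        also have "seq_mass 1 v = 1 / v"
          using v by (cases v) (auto simp: seq_mass_def)
        finally show "?D v \<le> u 1 * (1 / real v)" .
      qed
      then show ?thesis unfolding bound_def using True by (simp add: sum_distrib_left)
    next
      case False
      define m where "m = Max ?T"
      have Tm: "t \<le> m" if "t \<in> ?T" for t using that finT by (simp add: m_def)
      have mT: "m \<in> ?T" using finT False by (auto simp: m_def intro!: Max_in)
      have T: "?T \<subseteq> {1..m}" using Tm Cons.prems by force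
      have mN: "m \<le> N" using mT Cons.prems by auto
      have k0: "0 < ?k" using False fin by (simp add: card_gt_0_iff)
      have km: "?k \<le> m" using card_mono[OF _ T] kT by simp
      let ?g = "u (Suc ?k) * seq_mass (Suc ?k) m"
      let ?M = "max (real (Suc ?k) / ?d) (u (Suc ?k))"
      \<comment> \<open>Below the current maximum acceptance wins nothing, so only the continuation
        value remains.\<close>
      have low: "?D v \<le> ?g" if v: "v \<in> {1..m} - ?T" for v
      proof (intro convex_comb_le q)
        have "v < m" using v mT by (metis DiffD1 DiffD2 atLeastAtMost_iff le_neq_implies_less)
        have "Max (insert v ?T) = m"
          using v finT mT Tm by (intro Max_eqI) auto
        then show "?L v \<le> ?g" using L[of v] v mN by auto
        have "?W v = 0"
        proof (rule level_sum_eq_0)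
          fix y assume y: "\<And>a. a \<notin> set ?rs \<Longrightarrow> y a = (x(e := v)) a"
          obtain b where b: "b \<in> ?A" "x b = m" using mT by auto
          have "y b = m" "y e = v" using y b e by auto
          moreover have "y b \<le> Max (y ` S)" using b fin by simp
          ultimately show "dens S y * win S y e = 0" using \<open>v < m\<close> by (simp add: win_def)
        qed
        then show "?W v \<le> ?g" using u0 seq_mass_nonneg by simp
      qed
      \<comment> \<open>Three kinds of levels: repetitions of mass zero, levels below the maximum,
        and records, where the better of taking and passing counts.\<close>
      have "{1..N} = ?T \<union> (({1..m} - ?T) \<union> {m<..N})" using T mN by auto
      moreover have "?T \<inter> (({1..m} - ?T) \<union> {m<..N}) = {}" using T by auto
      moreover have "({1..m} - ?T) \<inter> {m<..N} = {}" by auto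
      ultimately have "(\<Sum>v\<in>{1..N}. ?D v) =
          sum ?D ?T + (sum ?D ({1..m} - ?T) + sum ?D {m<..N})"
        using finT by (simp only: sum.union_disjoint finite_Un finite_Diff finite_atLeastAtMost
            finite_greaterThanAtMost)
      moreover have "sum ?D ?T = 0" using bad by (intro sum.neutral) blast
      ultimately have split: "(\<Sum>v\<in>{1..N}. ?D v) = sum ?D ({1..m} - ?T) + sum ?D {m<..N}"
        by simp
      have "sum ?D ({1..m} - ?T) \<le> (\<Sum>v\<in>{1..m} - ?T. ?g)"
        by (intro sum_mono low)
      also have "\<dots> = u (Suc ?k) * (real (m - ?k) * seq_mass (Suc ?k) m)"
        using card_Diff_subset[OF finT T] kT by (simp only: sum_constant card_atLeastAtMost) simp
      also have "\<dots> \<le> u (Suc ?k) * (real ?k / (real ?k + 1) * seq_mass ?k m)"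
        by (intro mult_left_mono seq_mass_step_le k0 u0)
      finally have part1: "sum ?D ({1..m} - ?T) \<le> u (Suc ?k) * (real ?k / (real ?k + 1) * seq_mass ?k m)" .
      have "sum ?D {m<..N} \<le> (\<Sum>v\<in>{m<..N}. ?M * seq_mass (Suc ?k) v)"
      proof (intro sum_mono Drec)
        fix v assume v: "v \<in> {m<..N}"
        then show "v \<in> {1..N}" by simp
        show "\<forall>t\<in>?T. t < v" using Tm v by (meson greaterThanAtMost_iff le_less_trans)
      qed
      also have "\<dots> = ?M * (\<Sum>v\<in>{m<..N}. seq_mass (Suc ?k) v)"
        by (simp only: sum_distrib_left)
      also have "\<dots> \<le> ?M * (seq_mass ?k m / (real ?k + 1))"
        by (intro mult_left_mono seq_mass_tail_le k0 km) (use u0 in \<open>auto simp: max_def\<close>)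
      finally have part2: "sum ?D {m<..N} \<le> ?M * (seq_mass ?k m / (real ?k + 1))" .
      have *: "(\<Sum>v\<in>{1..N}. ?D v) \<le>
          (u (Suc ?k) * (real ?k / (real ?k + 1)) + ?M / (real ?k + 1)) * seq_mass ?k m"
        using split part1 part2 by (simp only: distrib_right) (simp add: mult.assoc)
      have "u (Suc ?k) * (real ?k / (real ?k + 1)) + max (real (Suc ?k) / ?d) (u (Suc ?k)) / (real ?k + 1) \<le> u ?k"
        by (intro value_step u2 u3) (use k0 Ad in simp_all)
      then have "(\<Sum>v\<in>{1..N}. ?D v) \<le> u ?k * seq_mass ?k m"
        using * mult_right_mono[OF _ seq_mass_nonneg] by (meson order_trans)
      then show ?thesis unfolding bound_def m_def using False by simp
    qed
    then show ?thesis unfolding step .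
  qed
qed

section \<open>The value function of the secretary problem\<close>

lemma ln_le_div_exp:
  fixes y :: real
  assumes "0 < y"
  shows "ln y \<le> y / exp 1"
proof -
  have "ln (y / exp 1) \<le> y / exp 1 - 1" using assms by (intro ln_le_minus_one) simp
  then show ?thesis using assms by (simp add: ln_div)
qed

text \<open>A supersolution of the optimality equation. Taking the first record after item
  \<open>k\<close> wins with probability \<open>k / d\<close> times the sum of \<open>1 / i\<close>
  for \<open>i\<close> from \<open>k\<close> to \<open>d - 1\<close>; \<open>L k\<close> bounds this
  sum by an integral. Up to the threshold the constant \<open>C\<close> serves: \<open>1 / e\<close>
  is the maximum of \<open>t * ln (1 / t)\<close>, and \<open>ln d / d\<close> pays for the shift
  from \<open>k\<close> to \<open>k - 1\<close>.\<close>

lemma secretary_value_function: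
  fixes d :: nat
  assumes d: "6 \<le> d"
  defines "C \<equiv> 1 / exp 1 + ln (real d) / real d"
  shows "\<exists>u :: nat \<Rightarrow> real. (\<forall>k. 0 \<le> u k) \<and> u 1 = C \<and> 1 / real d \<le> C \<and>
    (\<forall>k. 1 \<le> k \<longrightarrow> k < d \<longrightarrow> u (Suc k) \<le> u k) \<and>
    (\<forall>k. 1 \<le> k \<longrightarrow> k < d \<longrightarrow> 1 / real d + real k / (real k + 1) * u (Suc k) \<le> u k)"
proof -
  define L where "L k = ln ((real d - 1) / (real k - 1))" for k :: nat
  define \<tau> where "\<tau> = nat \<lfloor>C * d\<rfloor>"
  define u where "u k = (if k \<le> \<tau> then C else if k \<le> d then real k / d * L k else 0)" for k
  have d0: "0 < real d" using d by simp
  have C0: "0 \<le> C" unfolding C_def using d by (intro add_nonneg_nonneg) auto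
  have Cd: "d / exp 1 \<le> C * d"
    unfolding C_def using d by (simp add: distrib_right)
  \<comment> \<open>Here \<open>6 = 2 * 3\<close> and \<open>exp 1 \<le> 3\<close> enter: the
    threshold is at least 2, which keeps \<open>L\<close> away from its pole at
    \<open>k = 1\<close>.\<close>
  have "2 \<le> d / exp 1" using exp_le d by (simp add: field_simps)
  then have \<tau>2: "2 \<le> \<tau>" using Cd unfolding \<tau>_def by linarith
  have tau_le: "real \<tau> \<le> C * d" unfolding \<tau>_def using C0 by simp
  have tau_gt: "C * d < real \<tau> + 1" unfolding \<tau>_def using C0 d0 by linarith
  have L0: "0 \<le> L k" if "2 \<le> k" "k \<le> d" for k
    unfolding L_def using that by (intro ln_ge_zero) (simp add: field_simps)
  have bound: "real k / d * L k \<le> C" if k: "2 \<le> k" "k \<le> d" for k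
  proof -
    let ?t = "real k - 1"
    have t: "1 \<le> ?t" using k by simp
    have "L k \<le> ln (d / ?t)" unfolding L_def using t d k by (simp add: divide_right_mono)
    then have "real k / d * L k \<le> real k / d * ln (d / ?t)" by (intro mult_left_mono) auto
    also have "\<dots> = ?t / d * ln (d / ?t) + ln (d / ?t) / d"
      by (simp add: diff_divide_distrib left_diff_distrib)
    also have "?t / d * ln (d / ?t) \<le> ?t / d * (d / ?t / exp 1)"
      using t d0 by (intro mult_left_mono ln_le_div_exp) auto
    also have "\<dots> = 1 / exp 1" using t d0 by simp
    also have "ln (d / ?t) / d \<le> ln d / d"
      using t d0 by (intro divide_right_mono) (auto simp: field_simps)
    finally show ?thesis unfolding C_def by simp
  qed
  have Lstep: "1 / real k + L (Suc k) \<le> L k" if k: "2 \<le> k" "k < d" for k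
  proof -
    have k1: "1 \<le> real k - 1" using k by simp
    have "ln ((real k - 1) / k) \<le> (real k - 1) / k - 1"
      using k1 by (intro ln_le_minus_one) auto
    then have "1 / k \<le> ln k - ln (real k - 1)" using k1 by (simp add: ln_div field_simps)
    moreover have "L k = ln (real d - 1) - ln (real k - 1)" "L (Suc k) = ln (real d - 1) - ln k"
      unfolding L_def using k k1 d by (auto simp: ln_div)
    ultimately show ?thesis by simp
  qed
  have step: "1 / d + real k / d * L (Suc k) \<le> real k / d * L k" if k: "2 \<le> k" "k < d" for k
  proof -
    have "real k / d * (1 / real k + L (Suc k)) \<le> real k / d * L k"
      using Lstep[OF k] by (intro mult_left_mono) auto
    then show ?thesis using k by (simp add: distrib_left)
  qed
  have next_eq: "real k / (real k + 1) * (real (Suc k) / d * l) = real k / d * l" for k :: nat and l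
  proof -
    have "k' / a * (a / d * l) = k' / d * l" if "a \<noteq> 0" for k' a :: real using that by simp
    from this[of "real k + 1" "real k"] show ?thesis by (simp add: add.commute)
  qed
  have "1 / d \<le> C"
  proof -
    have "1 \<le> ln (real d)" using exp_le d by (subst ln_ge_iff) auto
    then have "1 / d \<le> ln d / d" by (intro divide_right_mono) auto
    then show ?thesis unfolding C_def by (simp add: add_increasing)
  qed
  moreover have "u 1 = C" using \<tau>2 by (simp add: u_def)
  moreover have "0 \<le> u k" for k
    using C0 L0[of k] \<tau>2 by (auto simp: u_def)
  moreover have "u (Suc k) \<le> u k" if k: "1 \<le> k" "k < d" for k
  proof (cases "Suc k \<le> \<tau>")
    case True
    then show ?thesis by (simp add: u_def)
  next
    case False
    then have u1: "u (Suc k) = real (Suc k) / d * L (Suc k)" using k by (simp add: u_def)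
    show ?thesis
    proof (cases "k \<le> \<tau>")
      case True
      then show ?thesis unfolding u1 using bound[of "Suc k"] k by (simp add: u_def)
    next
      case False
      then have k\<tau>: "real \<tau> + 1 \<le> real k" "2 \<le> k" using \<tau>2 by auto
      \<comment> \<open>Past the threshold \<open>L (Suc k) \<le> 1\<close>, so replacing the factor
        \<open>k\<close> by \<open>Suc k\<close> gains at most \<open>1 / d\<close>, which
        \<open>step\<close> absorbs.\<close>
      then have "d / exp 1 \<le> real k" using Cd tau_gt by linarith
      then have "(real d - 1) / k \<le> exp 1"
        using k by (simp add: field_simps)
      then have "L (Suc k) \<le> ln (exp 1)" unfolding L_def using k d
        by (subst ln_le_cancel_iff) auto
      then have "L (Suc k) / d \<le> 1 / d" by (intro divide_right_mono) auto
      moreover have "u (Suc k) = real k / d * L (Suc k) + L (Suc k) / d"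
        unfolding u1 by (simp add: add_divide_distrib distrib_right)
      moreover have "u k = real k / d * L k" using False k by (simp add: u_def)
      ultimately show ?thesis using step[of k] k k\<tau> by linarith
    qed
  qed
  moreover have "1 / real d + real k / (real k + 1) * u (Suc k) \<le> u k" if k: "1 \<le> k" "k < d" for k
  proof (cases "Suc k \<le> \<tau>")
    case True
    \<comment> \<open>Up to the threshold a record taken at item \<open>k + 1\<close> wins with
      probability at most \<open>C\<close>, so the constant satisfies the recursion.\<close>
    then have "real k + 1 \<le> C * d" using tau_le by linarith
    then have "1 / real d \<le> C / (real k + 1)"
      using d0 by (simp add: field_simps)
    moreover have "real k / (real k + 1) * C = C - C / (real k + 1)"
      by (simp add: field_simps)
    ultimately have "1 / real d + real k / (real k + 1) * C \<le> C" by linarith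
    then show ?thesis using True by (simp add: u_def)
  next
    case False
    then have u1: "u (Suc k) = real (Suc k) / d * L (Suc k)" using k by (simp add: u_def)
    have k2: "2 \<le> k" using False \<tau>2 by linarith
    have "1 / real d + real k / (real k + 1) * u (Suc k) \<le> real k / d * L k"
      unfolding u1 next_eq using step[OF k2 k(2)] .
    also have "\<dots> \<le> u k" using bound[OF k2] k by (simp add: u_def)
    finally show ?thesis .
  qed
  ultimately show ?thesis by (intro exI[of _ u]) blast
qed

section \<open>Choice of the star size and of the truncation level\<close>

lemma ex_ln_over_n_le:
  fixes \<delta> :: real
  assumes "0 < \<delta>"
  obtains d :: nat where "6 \<le> d" "ln (real d) / real d \<le> \<delta>"
proof -
  have "((\<lambda>n. ln (real n) / real n) \<longlongrightarrow> 0) sequentially"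
    by (rule lim_ln_over_n)
  then have "eventually (\<lambda>n. ln (real n) / real n < \<delta>) sequentially"
    using assms by (rule order_tendstoD)
  then have "eventually (\<lambda>n. ln (real n) / real n < \<delta> \<and> 6 \<le> n) sequentially"
    using eventually_ge_at_top by (rule eventually_conj)
  from eventually_happens'[OF sequentially_bot this]
  obtain n where "ln (real n) / real n < \<delta>" "6 \<le> n" by blast
  then show thesis using that[of n] by simp
qed

lemma ex_harmonic_tail_ratio:
  fixes C \<delta> :: real
  assumes "0 \<le> C" "0 < \<delta>"
  obtains N :: nat where "d \<le> N"
    "C * (\<Sum>v\<in>{1..N}. 1 / real v) \<le> (C + \<delta>) * (\<Sum>v\<in>{d..N}. 1 / real v)"
proof -
  let ?H = "\<lambda>N. \<Sum>v\<in>{1..N}. 1 / real v"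
  have "filterlim ?H at_top sequentially"
    using harm_at_top unfolding harm_def by (simp add: inverse_eq_divide)
  then have "eventually (\<lambda>N. (C + \<delta>) * ?H d / \<delta> \<le> ?H N \<and> d \<le> N) sequentially"
    by (intro eventually_conj eventually_ge_at_top) (simp add: filterlim_at_top)
  from eventually_happens'[OF sequentially_bot this]
  obtain N where N: "(C + \<delta>) * ?H d / \<delta> \<le> ?H N" "d \<le> N" by blast
  have "?H N \<le> (\<Sum>v\<in>{1..d} \<union> {d..N}. 1 / real v)"
    by (rule sum_mono2) auto
  also have "\<dots> \<le> ?H d + (\<Sum>v\<in>{d..N}. 1 / real v)"
    using sum.union_inter[of "{1..d}" "{d..N}" "\<lambda>v. 1 / real v"]
      sum_nonneg[of "{1..d} \<inter> {d..N}" "\<lambda>v. 1 / real v"] by simp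
  finally have "(C + \<delta>) * ?H N \<le> (C + \<delta>) * (?H d + (\<Sum>v\<in>{d..N}. 1 / real v))"
    using assms by (intro mult_left_mono) auto
  moreover have "(C + \<delta>) * ?H d \<le> \<delta> * ?H N"
    using N(1) assms by (simp add: field_simps)
  ultimately have "C * ?H N \<le> (C + \<delta>) * (\<Sum>v\<in>{d..N}. 1 / real v)"
    by (simp add: algebra_simps)
  then show thesis using that N(2) by blast
qed

section \<open>Decomposition into stars\<close>

lemma accepted_simps [simp]:
  "accepted [] = {}"
  "accepted (h @ [(e, x, True)]) = insert e (accepted h)"
  "accepted (h @ [(e, x, False)]) = accepted h"
  by (auto simp: accepted_def)

context star_graph
begin

definition touched :: "edge set \<Rightarrow> nat set" where
  "touched F = {a \<in> A. star a \<inter> F \<noteq> {}}"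

lemma finite_touched: "finite (touched F)"
  using finite_parts by (simp add: touched_def)

text \<open>The edges of \<open>F\<close> live on \<open>B\<close> and the centres of the touched
  stars, so the vertex bound for forests leaves at most \<open>card B\<close> edges beyond one per
  touched star.\<close>

lemma card_forest_le:
  assumes "F \<subseteq> E" "acyclic_edges F"
  shows "card F \<le> card (touched F) + card B"
proof -
  have "card F \<le> card (touched F \<union> B)"
  proof (rule acyclic_card_le[OF _ _ assms(2)])
    fix e assume "e \<in> F"
    then have e: "e \<in> E" "e \<in> F" using assms by auto
    then obtain a b where ab: "a \<in> A" "b \<in> B" "e = {a, b}" by (elim edge_cases)
    then have "a \<in> touched F" using e unfolding touched_def by auto
    then show "e \<subseteq> touched F \<union> B \<and> card e = 2" using ab edge_props(2)[OF e(1)] by simp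
  qed (use finite_parts finite_touched in simp)
  then show ?thesis using card_Un_le[of "touched F" B] by linarith
qed

lemma touched_insert:
  assumes "e \<in> E" "a \<in> A" "a \<in> e"
  shows "touched (insert e F) = insert a (touched F)"
  using assms edge_star_unique[OF assms(1)] unfolding touched_def by auto

text \<open>Every star contributes its first accepted edge; a forest contains at most \<open>card B\<close> further edges.\<close>
lemma exp_gain_le:
  assumes p: "valid_policy p" and w: "\<And>e. e \<in> E \<Longrightarrow> w e \<le> W" and W: "0 \<le> W"
    and es: "distinct es" "set es \<subseteq> E" "set es \<inter> accepted h = {}"
    and h: "accepted h \<subseteq> E" "acyclic_edges (accepted h)"
  shows "exp_gain p w h es \<le>
    (\<Sum>a\<in>A - touched (accepted h). first_gain p w (star a) w h es)
    + W * (real (card B) + real (card (touched (accepted h))) - real (card (accepted h)))"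
  using es h
proof (induction es arbitrary: h)
  case Nil
  then show ?case using card_forest_le[of "accepted h"] W by simp
next
  case (Cons e es)
  have e: "e \<in> E" "e \<notin> accepted h" "e \<notin> set es" using Cons.prems by auto
  obtain a where a: "a \<in> A" "a \<in> e" using edge_star_unique[OF e(1)] by blast
  have a_unique: "b = a" if "b \<in> A" "b \<in> e" for b
    using that a edge_star_unique[OF e(1)] by blast
  define h1 h2 where "h1 = h @ [(e, w e, True)]" and "h2 = h @ [(e, w e, False)]"
  define q where "q = acc_prob p h e (w e)"
  let ?F = "accepted h" and ?P = "A - touched (accepted h)"
  \<comment> \<open>Reserves \<open>W\<close> for each surplus edge still possible;
    \<open>card_forest_le\<close> makes it nonnegative when the arrivals end.\<close>
  define slack where
    "slack = (\<lambda>F. W * (real (card B) + real (card (touched F)) - real (card F)))"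
  let ?g1 = "\<lambda>b. if e \<in> star b then w e else first_gain p w (star b) w h1 es"
  let ?g2 = "\<lambda>b. first_gain p w (star b) w h2 es"
  have finF: "finite ?F" using Cons.prems finite_E finite_subset by blast
  have finP: "finite ?P" using finite_parts by simp
  have reject: "exp_gain p w h2 es \<le> sum ?g2 ?P + slack ?F"
    using Cons.IH[of h2] Cons.prems by (simp add: h2_def slack_def)
  have accept: "w e + exp_gain p w h1 es \<le> sum ?g1 ?P + slack ?F" if "q \<noteq> 0"
  proof -
    have ac: "acyclic_edges (insert e ?F)"
      using that by (auto simp: q_def acc_prob_def split: if_splits)
    have IH: "exp_gain p w h1 es \<le>
        (\<Sum>b\<in>A - touched (insert e ?F). first_gain p w (star b) w h1 es) + slack (insert e ?F)"
      using Cons.IH[of h1] Cons.prems ac e by (simp add: h1_def slack_def)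
    have t: "touched (insert e ?F) = insert a (touched ?F)" by (rule touched_insert[OF e(1) a])
    have rest: "(\<Sum>b\<in>?P - {a}. first_gain p w (star b) w h1 es) = sum ?g1 (?P - {a})"
      by (intro sum.cong refl) (use a_unique in auto)
    \<comment> \<open>A surplus edge lowers \<open>slack\<close> by \<open>W\<close>, which covers
      its weight; the first edge of a star leaves \<open>slack\<close> unchanged and is paid by the
      term \<open>?g1 a\<close>.\<close>
    show ?thesis
    proof (cases "a \<in> touched ?F")
      case True
      then have "insert a (touched ?F) = touched ?F" "?P - {a} = ?P" by auto
      moreover have "slack (insert e ?F) = slack ?F - W"
        using \<open>insert a (touched ?F) = touched ?F\<close> t e finF by (simp add: slack_def algebra_simps)
      ultimately show ?thesis using IH rest w[OF e(1)] t by simp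
    next
      case False
      have "A - insert a (touched ?F) = ?P - {a}" by blast
      moreover have "slack (insert e ?F) = slack ?F"
        using False t e finF finite_touched by (simp add: slack_def)
      moreover have "sum ?g1 ?P = ?g1 a + sum ?g1 (?P - {a})"
        using finP False a by (intro sum.remove) auto
      moreover have "?g1 a = w e" using a e by simp
      ultimately show ?thesis using IH rest t by simp
    qed
  qed
  have "exp_gain p w h (e # es) = q * (w e + exp_gain p w h1 es) + (1 - q) * exp_gain p w h2 es"
    unfolding exp_gain_Cons q_def h1_def h2_def ..
  also have "\<dots> \<le> q * (sum ?g1 ?P + slack ?F) + (1 - q) * (sum ?g2 ?P + slack ?F)"
  proof (cases "q = 0")
    case False
    then show ?thesis
      using accept reject acc_prob_bounds[OF p] by (intro convex_comb_mono) (auto simp: q_def)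
  qed (use reject in simp)
  also have "\<dots> = q * sum ?g1 ?P + (1 - q) * sum ?g2 ?P + slack ?F"
    by (simp add: algebra_simps)
  also have "q * sum ?g1 ?P + (1 - q) * sum ?g2 ?P = (\<Sum>b\<in>?P. q * ?g1 b + (1 - q) * ?g2 b)"
    by (simp only: sum.distrib sum_distrib_left)
  also have "\<dots> = (\<Sum>b\<in>?P. first_gain p w (star b) w h (e # es))"
    by (intro sum.cong refl) (simp add: q_def h1_def h2_def)
  finally show ?case by (simp add: slack_def)
qed

lemma star_nonempty:
  assumes "0 < d" "a \<in> A"
  shows "star a \<noteq> {}" "finite (star a)"
  using star_card[OF assms(2)] assms(1) finite_E by fastforce+

text \<open>One heaviest edge per star gives a forest: each vertex of \<open>A\<close> lies on only
  one of these edges, while a cycle passes through a vertex of \<open>A\<close> and uses two edges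
  there.\<close>

lemma OPT_ge:
  fixes w :: weight
  assumes d: "0 < d"
  shows "(\<Sum>a\<in>A. Max (w ` star a)) \<le> OPT E w"
proof -
  have "\<forall>a\<in>A. \<exists>e. e \<in> star a \<and> w e = Max (w ` star a)"
  proof
    fix a assume "a \<in> A"
    then have "Max (w ` star a) \<in> w ` star a"
      using star_nonempty[OF d] by (intro Max_in) auto
    then show "\<exists>e. e \<in> star a \<and> w e = Max (w ` star a)" by force
  qed
  from bchoice[OF this] obtain f
    where f: "\<And>a. a \<in> A \<Longrightarrow> f a \<in> star a" "\<And>a. a \<in> A \<Longrightarrow> w (f a) = Max (w ` star a)"
    by blast
  have f_unique: "a = b" if "a \<in> A" "b \<in> A" "a \<in> f b" for a b
    using that f(1)[OF that(2)] edge_star_unique[of "f b"] by auto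
  have inj: "inj_on f A"
    using f(1) f_unique by (intro inj_onI) (metis (mono_tags, lifting) mem_Collect_eq)
  have sub: "f ` A \<subseteq> E" using f(1) by auto
  have "acyclic_edges (f ` A)"
    unfolding acyclic_edges_def
  proof
    assume "\<exists>vs. is_cycle (f ` A) vs"
    then obtain vs where vs: "is_cycle (f ` A) vs" ..
    then have l: "3 \<le> length vs" and "{vs ! 0, vs ! ((0 + 1) mod length vs)} \<in> f ` A"
      by (fastforce simp: is_cycle_def)+
    then have "{vs ! 0, vs ! 1} \<in> E" using sub by auto
    then obtain a where a: "a \<in> A" "a \<in> {vs ! 0, vs ! 1}" using edge_star_unique by blast
    have "vs ! 0 \<in> set vs" "vs ! 1 \<in> set vs" using l by (auto intro!: nth_mem)
    then have "a \<in> set vs" using a by auto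
    then obtain e e' where "e \<in> f ` A" "e' \<in> f ` A" "e \<noteq> e'" "a \<in> e" "a \<in> e'"
      by (rule cycle_edges_at[OF vs])
    then show False using f_unique a by (metis imageE)
  qed
  then have "sum w (f ` A) \<in> {sum w F | F. F \<subseteq> E \<and> acyclic_edges F}" using sub by blast
  moreover have "finite {sum w F | F. F \<subseteq> E \<and> acyclic_edges F}"
    by (rule finite_subset[of _ "sum w ` Pow E"]) (use finite_E in auto)
  ultimately have "sum w (f ` A) \<le> OPT E w" unfolding OPT_def by (intro Max_ge)
  moreover have "sum w (f ` A) = (\<Sum>a\<in>A. Max (w ` star a))"
    using f(2) by (simp add: sum.reindex[OF inj])
  ultimately show ?thesis by simp
qed

end

section \<open>The hard distribution\<close>

lemma level_sum_nonneg:
  assumes "\<And>y. 0 \<le> F y"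
  shows "0 \<le> level_sum N es F x"
  by (induction es arbitrary: x) (auto simp: assms intro: sum_nonneg)

lemma level_sum_mult_const:
  assumes "\<And>y. (\<And>e. e \<notin> set es \<Longrightarrow> y e = x e) \<Longrightarrow> R y = R x"
  shows "level_sum N es (\<lambda>y. R y * F y) x = R x * level_sum N es F x"
proof -
  have "level_sum N es (\<lambda>y. R y * F y) x = level_sum N es (\<lambda>y. R x * F y + 0 * F y) x"
  proof (rule level_sum_cong)
    fix y assume "\<And>e. e \<notin> set es \<Longrightarrow> y e = x e"
    then have "R y = R x" by (rule assms)
    then show "R y * F y = R x * F y + 0 * F y" by simp
  qed
  also have "\<dots> = R x * level_sum N es F x + 0 * level_sum N es F x" by (rule level_sum_linear)
  finally show ?thesis by simp
qed

lemma sum_PiE_insert: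
  fixes F :: "('e \<Rightarrow> 'v) \<Rightarrow> real"
  assumes "e \<notin> T"
  shows "(\<Sum>x\<in>PiE (insert e T) (\<lambda>_. I). F x) = (\<Sum>y\<in>PiE T (\<lambda>_. I). \<Sum>v\<in>I. F (y(e := v)))"
proof -
  have "(\<Sum>x\<in>PiE (insert e T) (\<lambda>_. I). F x) = (\<Sum>(v, y)\<in>I \<times> PiE T (\<lambda>_. I). F (y(e := v)))"
    unfolding PiE_insert_eq
    by (subst sum.reindex[OF inj_combinator[OF assms]]) (simp add: case_prod_unfold o_def)
  also have "\<dots> = (\<Sum>v\<in>I. \<Sum>y\<in>PiE T (\<lambda>_. I). F (y(e := v)))"
    by (simp add: sum.cartesian_product)
  also have "\<dots> = (\<Sum>y\<in>PiE T (\<lambda>_. I). \<Sum>v\<in>I. F (y(e := v)))"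
    by (rule sum.swap)
  finally show ?thesis .
qed

text \<open>The order of \<open>rs\<close> is free, so the inner sums over one star can follow any
  given arrival order.\<close>

lemma sum_PiE_level_sum:
  assumes "distinct rs" "set rs \<inter> T = {}"
  shows "(\<Sum>x\<in>PiE (T \<union> set rs) (\<lambda>_. {1..N}). F x) = (\<Sum>y\<in>PiE T (\<lambda>_. {1..N}). level_sum N rs F y)"
  using assms
proof (induction rs arbitrary: T)
  case (Cons e rs)
  then have e: "e \<notin> T" by auto
  have T: "T \<union> set (e # rs) = insert e T \<union> set rs" by simp
  have "(\<Sum>x\<in>PiE (insert e T \<union> set rs) (\<lambda>_. {1..N}). F x) =
      (\<Sum>y\<in>PiE (insert e T) (\<lambda>_. {1..N}). level_sum N rs F y)"
    by (rule Cons.IH) (use Cons.prems in auto)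
  also have "\<dots> = (\<Sum>y\<in>PiE T (\<lambda>_. {1..N}). \<Sum>v\<in>{1..N}. level_sum N rs F (y(e := v)))"
    by (rule sum_PiE_insert[OF e])
  finally show ?case unfolding T by simp
qed simp

lemma dens_cong: "(\<And>e. e \<in> S \<Longrightarrow> x e = y e) \<Longrightarrow> dens S x = dens S y"
  unfolding dens_def by (metis (no_types, lifting) image_cong inj_on_cong)

lemma dens_sum_win:
  assumes "finite S" "S \<noteq> {}"
  shows "(\<Sum>e\<in>S. dens S x * win S x e) = dens S x"
proof (cases "inj_on x S")
  case True
  have "Max (x ` S) \<in> x ` S" using assms by (intro Max_in) auto
  then obtain e0 where e0: "e0 \<in> S" "x e0 = Max (x ` S)" by (auto simp: image_iff)
  have "(\<Sum>e\<in>S. dens S x * win S x e) = (\<Sum>e\<in>S. if e = e0 then dens S x else 0)"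
    by (intro sum.cong refl) (use True e0 in \<open>auto simp: win_def inj_on_def\<close>)
  then show ?thesis using e0 assms by simp
qed (simp add: dens_def)

text \<open>With \<open>e\<close> listed first it is the only seen edge, and
  \<open>level_sum_win_eq\<close> gives \<open>1 / v / card S\<close> for each level
  \<open>v\<close> from \<open>card S\<close> on; smaller levels are dropped as nonnegative.\<close>

lemma level_sum_win_from_start:
  assumes S: "finite S" "e \<in> S" and rs: "distinct rs" "set rs = S - {e}"
  shows "(\<Sum>v\<in>{card S..N}. 1 / real v) / card S \<le> level_sum N (e # rs) (\<lambda>y. dens S y * win S y e) x"
proof -
  have d: "0 < card S" using S by (auto simp: card_gt_0_iff)
  have seen: "S - set rs = {e}" using S rs by auto
  have "(\<Sum>v\<in>{card S..N}. 1 / real v) / card S = (\<Sum>v\<in>{card S..N}. 1 / real v / card S)"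
    by (simp add: sum_divide_distrib)
  also have "\<dots> = (\<Sum>v\<in>{card S..N}. level_sum N rs (\<lambda>y. dens S y * win S y e) (x(e := v)))"
  proof (intro sum.cong refl)
    fix v assume v: "v \<in> {card S..N}"
    have "level_sum N rs (\<lambda>y. dens S y * win S y e) (x(e := v)) =
        real (card (S - set rs)) / card S * seq_mass (card (S - set rs)) ((x(e := v)) e)"
      by (rule level_sum_win_eq) (use S rs v d seen in auto)
    also have "\<dots> = 1 / card S * seq_mass 1 v" unfolding seen by simp
    also have "seq_mass 1 v = 1 / v" using v d by (cases v) (auto simp: seq_mass_def)
    finally show "1 / real v / card S = level_sum N rs (\<lambda>y. dens S y * win S y e) (x(e := v))"
      by (simp only: divide_divide_eq_left times_divide_times_eq mult.commute mult_1)
  qed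
  also have "\<dots> \<le> (\<Sum>v\<in>{1..N}. level_sum N rs (\<lambda>y. dens S y * win S y e) (x(e := v)))"
    by (rule sum_mono2) (use d in \<open>auto intro!: level_sum_nonneg mult_nonneg_nonneg dens_nonneg simp: win_def\<close>)
  finally show ?thesis by simp
qed

lemma level_sum_first_gain_le_secretary:
  assumes p: "valid_policy p" and S: "finite S" "6 \<le> card S"
    and es: "distinct es" "S \<subseteq> set es"
  shows "level_sum N (filter (\<lambda>e. e \<in> S) es)
      (\<lambda>y. dens S y * first_gain p (\<omega> \<circ> y) S (win S y) h es) x
    \<le> (1 / exp 1 + ln (card S) / card S) * (\<Sum>v\<in>{1..N}. 1 / real v)"
proof -
  obtain u :: "nat \<Rightarrow> real" where u: "\<And>k. 0 \<le> u k" "u 1 = 1 / exp 1 + ln (card S) / card S"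
    "1 / real (card S) \<le> u 1"
    "\<And>k. 1 \<le> k \<Longrightarrow> k < card S \<Longrightarrow> u (Suc k) \<le> u k"
    "\<And>k. 1 \<le> k \<Longrightarrow> k < card S \<Longrightarrow> 1 / real (card S) + real k / (real k + 1) * u (Suc k) \<le> u k"
    using secretary_value_function[OF S(2)] by metis
  have seen: "S - set es = {}" using es by blast
  have "inj_on x (S - set es)" "x ` (S - set es) \<subseteq> {1..N}" by (simp_all only: seen) auto
  from level_sum_first_gain_le[OF p S(1) u(1) u(3) u(4) u(5) es(1) this, of \<omega> h]
  show ?thesis unfolding seen u(2) by simp
qed

text \<open>A composition, to match the form \<open>\<omega> \<circ> y\<close> of the one-star
  bound.\<close>

definition level_weight :: "nat \<Rightarrow> (edge \<Rightarrow> nat) \<Rightarrow> weight" where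
  "level_weight K x = (\<lambda>n. real K ^ n) \<circ> x"

text \<open>Levels are integers, so an edge that is not maximal is lighter than the maximum by a
  factor of at least \<open>K\<close>.\<close>

lemma level_weight_le_win:
  assumes "finite S" "e \<in> S" "1 \<le> K"
  shows "level_weight K x e / real K ^ Max (x ` S) \<le> win S x e + 1 / real K"
proof (cases "x e = Max (x ` S)")
  case True
  then show ?thesis using assms by (simp add: win_def level_weight_def)
next
  case False
  have "x e \<le> Max (x ` S)" using assms by simp
  then have "Suc (x e) \<le> Max (x ` S)" using False by simp
  then have "real K ^ Suc (x e) \<le> real K ^ Max (x ` S)"
    using assms by (intro power_increasing) auto
  then have "real K ^ x e / real K ^ Max (x ` S) \<le> 1 / real K"
    using assms by (simp add: field_simps)
  then show ?thesis using False by (simp add: win_def level_weight_def)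
qed

section \<open>The joint density over all stars\<close>

lemma arrival_ordersD:
  assumes "xs \<in> arrival_orders E"
  shows "distinct xs" "set xs = E"
  using assms by (auto simp: arrival_orders_def)

locale weighted_star_graph = star_graph +
  fixes N K :: nat
  assumes K_pos: "1 \<le> K" and d_pos: "0 < d" and d_le_N: "d \<le> N"
begin

text \<open>The divisor is the largest weight in the star. Multiplying the joint density by it
  leaves \<open>dens (star a)\<close>, on which the one-star bounds are stated.\<close>

definition local_dens :: "nat \<Rightarrow> (edge \<Rightarrow> nat) \<Rightarrow> real" where
  "local_dens a x = dens (star a) x / real K ^ Max (x ` star a)"

definition joint_dens :: "(edge \<Rightarrow> nat) \<Rightarrow> real" where
  "joint_dens x = (\<Prod>a\<in>A. local_dens a x)"

definition other_dens :: "nat \<Rightarrow> (edge \<Rightarrow> nat) \<Rightarrow> real" where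
  "other_dens a x = (\<Prod>b\<in>A - {a}. local_dens b x)"

definition levels :: "(edge \<Rightarrow> nat) set" where
  "levels = PiE E (\<lambda>_. {1..N})"

text \<open>By \<open>joint_dens_split\<close>, the maximal weight of star \<open>a\<close> summed
  against \<open>joint_dens\<close>: the share of this star in the benchmark.\<close>

definition star_mass :: "nat \<Rightarrow> real" where
  "star_mass a = (\<Sum>x\<in>levels. other_dens a x * dens (star a) x)"

definition other_mass :: "nat \<Rightarrow> real" where
  "other_mass a = (\<Sum>y\<in>PiE (E - star a) (\<lambda>_. {1..N}). other_dens a y)"

lemma finite_levels: "finite levels"
  unfolding levels_def by (intro finite_PiE finite_E) auto

lemma local_dens_nonneg: "0 \<le> local_dens a x"
  by (simp add: local_dens_def dens_nonneg)

lemma joint_dens_nonneg: "0 \<le> joint_dens x"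
  by (simp add: joint_dens_def prod_nonneg local_dens_nonneg)

lemma other_dens_nonneg: "0 \<le> other_dens a x"
  by (simp add: other_dens_def prod_nonneg local_dens_nonneg)

lemma other_mass_nonneg: "0 \<le> other_mass a"
  by (simp add: other_mass_def sum_nonneg other_dens_nonneg)

lemma joint_dens_split:
  assumes "a \<in> A"
  shows "joint_dens x = other_dens a x * dens (star a) x / real K ^ Max (x ` star a)"
  unfolding joint_dens_def other_dens_def
  by (subst prod.remove[OF finite_parts(1) assms]) (simp add: local_dens_def)

lemma other_dens_cong:
  assumes "a \<in> A" "\<And>e. e \<notin> star a \<Longrightarrow> y e = x e"
  shows "other_dens a y = other_dens a x"
  unfolding other_dens_def
proof (intro prod.cong refl)
  fix b assume b: "b \<in> A - {a}"
  have "y e = x e" if "e \<in> star b" for e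
    using that b assms edge_star_unique[of e] by (intro assms(2)) auto
  then have "dens (star b) y = dens (star b) x" "y ` star b = x ` star b"
    by (auto intro!: dens_cong image_cong)
  then show "local_dens b y = local_dens b x" by (simp add: local_dens_def)
qed

text \<open>\<open>other_dens a\<close> ignores the levels inside star \<open>a\<close>, so it
  leaves the inner sums, and one-star estimates apply for each fixed assignment to the rest.\<close>

lemma sum_levels_star:
  assumes a: "a \<in> A" and rs: "distinct rs" "set rs = star a"
  shows "(\<Sum>x\<in>levels. other_dens a x * F x) =
     (\<Sum>y\<in>PiE (E - star a) (\<lambda>_. {1..N}). other_dens a y * level_sum N rs F y)"
proof -
  have E: "E = (E - star a) \<union> set rs" using rs by auto
  have "(\<Sum>x\<in>levels. other_dens a x * F x) =
     (\<Sum>x\<in>PiE ((E - star a) \<union> set rs) (\<lambda>_. {1..N}). other_dens a x * F x)"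
    unfolding levels_def using E by simp
  also have "\<dots> = (\<Sum>y\<in>PiE (E - star a) (\<lambda>_. {1..N}). level_sum N rs (\<lambda>x. other_dens a x * F x) y)"
    by (rule sum_PiE_level_sum) (use rs in auto)
  also have "\<dots> = (\<Sum>y\<in>PiE (E - star a) (\<lambda>_. {1..N}). other_dens a y * level_sum N rs F y)"
    by (intro sum.cong refl level_sum_mult_const other_dens_cong[OF a]) (use rs in auto)
  finally show ?thesis .
qed

text \<open>Some edge of the star is its maximum, and each of the \<open>d\<close> edges is so with
  at least a \<open>d\<close>-th part of the mass.\<close>

lemma star_mass_ge:
  assumes a: "a \<in> A"
  shows "other_mass a * (\<Sum>v\<in>{d..N}. 1 / real v) \<le> star_mass a"
proof -
  let ?S = "star a" and ?Z = "\<Sum>v\<in>{d..N}. 1 / real v"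
  have S: "finite ?S" "?S \<noteq> {}" "card ?S = d"
    using star_nonempty[OF d_pos a] star_card[OF a] by auto
  have each: "other_mass a * (?Z / d) \<le> (\<Sum>x\<in>levels. other_dens a x * (dens ?S x * win ?S x e))"
    if e: "e \<in> ?S" for e
  proof -
    obtain rs where rs: "set rs = ?S - {e}" "distinct rs"
      using finite_distinct_list[of "?S - {e}"] S by auto
    have set: "set (e # rs) = ?S" using rs e by auto
    have dist: "distinct (e # rs)" using rs by simp
    have "other_mass a * (?Z / d) =
        (\<Sum>y\<in>PiE (E - ?S) (\<lambda>_. {1..N}). other_dens a y * (?Z / d))"
      by (simp only: other_mass_def sum_distrib_right)
    also have "\<dots> \<le> (\<Sum>y\<in>PiE (E - ?S) (\<lambda>_. {1..N}).
        other_dens a y * level_sum N (e # rs) (\<lambda>x. dens ?S x * win ?S x e) y)"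
      using level_sum_win_from_start[OF S(1) e rs(2,1), where N = N] S(3)
      by (intro sum_mono mult_left_mono other_dens_nonneg) simp
    also have "\<dots> = (\<Sum>x\<in>levels. other_dens a x * (dens ?S x * win ?S x e))"
      by (rule sum_levels_star[OF a dist set, symmetric])
    finally show ?thesis .
  qed
  have "other_mass a * ?Z = (\<Sum>e\<in>?S. other_mass a * (?Z / d))"
    using S(3) d_pos by simp
  also have "\<dots> \<le> (\<Sum>e\<in>?S. \<Sum>x\<in>levels. other_dens a x * (dens ?S x * win ?S x e))"
    by (intro sum_mono each)
  also have "\<dots> = (\<Sum>x\<in>levels. \<Sum>e\<in>?S. other_dens a x * (dens ?S x * win ?S x e))"
    by (rule sum.swap)
  also have "\<dots> = star_mass a"
    unfolding star_mass_def
    by (subst sum_distrib_left[symmetric], subst dens_sum_win[OF S(1,2)]) (rule refl)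
  finally show ?thesis .
qed

text \<open>Scaled by the largest weight of the star, the reward is \<open>win\<close> up to an
  error of \<open>1 / K\<close>, to which the secretary bound applies.\<close>

lemma sum_first_gain_le:
  assumes p: "valid_policy p" and d6: "6 \<le> d" and a: "a \<in> A" and xs: "xs \<in> arrival_orders E"
  shows "(\<Sum>x\<in>levels. joint_dens x *
      first_gain p (level_weight K x) (star a) (level_weight K x) [] xs) \<le>
    (1 / exp 1 + ln d / d) * (\<Sum>v\<in>{1..N}. 1 / real v) * other_mass a + star_mass a / K"
proof -
  let ?S = "star a" and ?C = "(1 / exp 1 + ln d / d) * (\<Sum>v\<in>{1..N}. 1 / real v)"
  let ?f = "\<lambda>x. first_gain p (level_weight K x) ?S (win ?S x) [] xs"
  have S: "finite ?S" "card ?S = d"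
    using star_nonempty[OF d_pos a] star_card[OF a] by auto
  let ?rs = "filter (\<lambda>e. e \<in> ?S) xs"
  have rs: "distinct ?rs" "set ?rs = ?S" using arrival_ordersD[OF xs] by auto
  have "joint_dens x * first_gain p (level_weight K x) ?S (level_weight K x) [] xs \<le>
      other_dens a x * (dens ?S x * ?f x) + other_dens a x * dens ?S x / K" for x
  proof -
    let ?M = "1 / real K ^ Max (x ` ?S)"
    have "joint_dens x * first_gain p (level_weight K x) ?S (level_weight K x) [] xs =
       other_dens a x * dens ?S x *
         first_gain p (level_weight K x) ?S (\<lambda>e. ?M * level_weight K x e) [] xs"
      unfolding joint_dens_split[OF a] first_gain_scale by simp
    also have "\<dots> \<le> other_dens a x * dens ?S x * (?f x + 1 / K)"
      using level_weight_le_win[OF S(1) _ K_pos]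
      by (intro mult_left_mono first_gain_le_add p mult_nonneg_nonneg other_dens_nonneg dens_nonneg) auto
    finally show ?thesis by (simp add: algebra_simps)
  qed
  then have "(\<Sum>x\<in>levels. joint_dens x *
      first_gain p (level_weight K x) (star a) (level_weight K x) [] xs) \<le>
    (\<Sum>x\<in>levels. other_dens a x * (dens ?S x * ?f x) + other_dens a x * dens ?S x / K)"
    by (rule sum_mono)
  also have "\<dots> = (\<Sum>x\<in>levels. other_dens a x * (dens ?S x * ?f x)) + star_mass a / K"
    by (simp add: sum.distrib star_mass_def sum_divide_distrib)
  also have "(\<Sum>x\<in>levels. other_dens a x * (dens ?S x * ?f x)) =
      (\<Sum>y\<in>PiE (E - ?S) (\<lambda>_. {1..N}). other_dens a y * level_sum N ?rs (\<lambda>x. dens ?S x * ?f x) y)"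
    by (rule sum_levels_star[OF a rs])
  also have "\<dots> \<le> (\<Sum>y\<in>PiE (E - ?S) (\<lambda>_. {1..N}). other_dens a y * ?C)"
    unfolding level_weight_def
    by (intro sum_mono mult_left_mono other_dens_nonneg
        level_sum_first_gain_le_secretary[OF p S(1), unfolded S(2)])
      (use d6 arrival_ordersD[OF xs] in auto)
  also have "\<dots> = ?C * other_mass a"
    by (simp only: other_mass_def sum_distrib_right[symmetric] mult.commute)
  finally show ?thesis by simp
qed

text \<open>Every maximal weight is at least one. This lets the loss from surplus edges, a multiple
  of the plain mass of \<open>joint_dens\<close>, be charged to the stars.\<close>

lemma sum_joint_dens_le_star_mass:
  assumes "a \<in> A"
  shows "(\<Sum>x\<in>levels. joint_dens x) \<le> star_mass a"
  unfolding star_mass_def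
proof (rule sum_mono)
  fix x
  have "1 \<le> real K ^ Max (x ` star a)" using K_pos by (intro one_le_power) simp
  moreover have "0 \<le> other_dens a x * dens (star a) x"
    by (intro mult_nonneg_nonneg other_dens_nonneg dens_nonneg)
  ultimately have "other_dens a x * dens (star a) x / real K ^ Max (x ` star a) \<le>
      other_dens a x * dens (star a) x / 1"
    using K_pos by (intro divide_left_mono) auto
  then show "joint_dens x \<le> other_dens a x * dens (star a) x"
    unfolding joint_dens_split[OF assms] by simp
qed

text \<open>The three \<delta> pay for the truncation of levels, for edges that are not maximal, and
  for \<open>card B\<close> surplus edges of weight at most \<open>K ^ N\<close>. The bound holds
  for every single arrival order, as the densities are symmetric in the edges of a star.\<close>

lemma sum_exp_gain_le:
  fixes \<delta> :: real
  defines "C \<equiv> 1 / exp 1 + ln d / d"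
  assumes p: "valid_policy p" and d6: "6 \<le> d" and xs: "xs \<in> arrival_orders E"
    and N: "C * (\<Sum>v\<in>{1..N}. 1 / real v) \<le> (C + \<delta>) * (\<Sum>v\<in>{d..N}. 1 / real v)"
    and K: "1 / real K \<le> \<delta>" and AB: "real K ^ N * card B \<le> \<delta> * card A"
  shows "(\<Sum>x\<in>levels. joint_dens x * exp_gain p (level_weight K x) [] xs) \<le>
           (C + 3 * \<delta>) * (\<Sum>a\<in>A. star_mass a)"
proof -
  let ?fg = "\<lambda>a x. first_gain p (level_weight K x) (star a) (level_weight K x) [] xs"
  have K0: "0 < real K" using K_pos by simp
  have \<delta>0: "0 \<le> \<delta>" using K K0 by (meson divide_nonneg_pos le_less_trans not_le zero_le_one order_trans)
  have C0: "0 \<le> C" unfolding C_def using d6 by (intro add_nonneg_nonneg) auto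
  have star: "(\<Sum>x\<in>levels. joint_dens x * ?fg a x) \<le> (C + 2 * \<delta>) * star_mass a" if a: "a \<in> A" for a
  proof -
    have m: "0 \<le> star_mass a"
      unfolding star_mass_def by (intro sum_nonneg mult_nonneg_nonneg other_dens_nonneg dens_nonneg)
    have "C * (\<Sum>v\<in>{1..N}. 1 / real v) * other_mass a \<le> (C + \<delta>) * (\<Sum>v\<in>{d..N}. 1 / real v) * other_mass a"
      by (rule mult_right_mono[OF N other_mass_nonneg])
    also have "\<dots> = (C + \<delta>) * (other_mass a * (\<Sum>v\<in>{d..N}. 1 / real v))" by simp
    also have "\<dots> \<le> (C + \<delta>) * star_mass a"
      using C0 \<delta>0 by (intro mult_left_mono star_mass_ge[OF a]) auto
    finally have "C * (\<Sum>v\<in>{1..N}. 1 / real v) * other_mass a \<le> (C + \<delta>) * star_mass a" .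
    moreover have "star_mass a / K \<le> \<delta> * star_mass a"
      using mult_right_mono[OF K m] by simp
    ultimately show ?thesis
      using sum_first_gain_le[OF p d6 a xs] unfolding C_def by (simp add: algebra_simps)
  qed
  have gain: "exp_gain p (level_weight K x) [] xs \<le> (\<Sum>a\<in>A. ?fg a x) + real K ^ N * card B"
    if x: "x \<in> levels" for x
  proof -
    have "level_weight K x e \<le> real K ^ N" if "e \<in> E" for e
    proof -
      have "x e \<le> N" using x that unfolding levels_def by (auto dest: PiE_mem)
      then show ?thesis using K_pos by (simp add: level_weight_def power_increasing)
    qed
    moreover have "acyclic_edges {}"
      by (auto simp: acyclic_edges_def is_cycle_def intro!: exI[of _ 0])
    moreover have "touched {} = {}" by (simp add: touched_def)
    ultimately show ?thesis
      using exp_gain_le[OF p, of "level_weight K x" "real K ^ N" xs "[]"] arrival_ordersD[OF xs]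
      by simp
  qed
  have "(\<Sum>x\<in>levels. joint_dens x * exp_gain p (level_weight K x) [] xs) \<le>
      (\<Sum>x\<in>levels. joint_dens x * ((\<Sum>a\<in>A. ?fg a x) + real K ^ N * card B))"
    by (intro sum_mono mult_left_mono gain joint_dens_nonneg)
  also have "\<dots> = (\<Sum>x\<in>levels. \<Sum>a\<in>A. joint_dens x * ?fg a x) +
      real K ^ N * card B * (\<Sum>x\<in>levels. joint_dens x)"
    by (simp add: distrib_left sum.distrib sum_distrib_left mult_ac)
  also have "(\<Sum>x\<in>levels. \<Sum>a\<in>A. joint_dens x * ?fg a x) =
      (\<Sum>a\<in>A. \<Sum>x\<in>levels. joint_dens x * ?fg a x)" by (rule sum.swap)
  also have "\<dots> \<le> (\<Sum>a\<in>A. (C + 2 * \<delta>) * star_mass a)" by (intro sum_mono star)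
  also have "\<dots> = (C + 2 * \<delta>) * (\<Sum>a\<in>A. star_mass a)" by (simp only: sum_distrib_left)
  also have "real K ^ N * card B * (\<Sum>x\<in>levels. joint_dens x) \<le> \<delta> * card A * (\<Sum>x\<in>levels. joint_dens x)"
    by (intro mult_right_mono AB sum_nonneg joint_dens_nonneg)
  also have "\<dots> = \<delta> * (\<Sum>a\<in>A. \<Sum>x\<in>levels. joint_dens x)" by simp
  also have "\<dots> \<le> \<delta> * (\<Sum>a\<in>A. star_mass a)"
    by (intro mult_left_mono sum_mono sum_joint_dens_le_star_mass \<delta>0)
  finally show ?thesis by (simp add: algebra_simps)
qed

lemma sum_OPT_ge:
  "(\<Sum>a\<in>A. star_mass a) \<le> (\<Sum>x\<in>levels. joint_dens x * OPT E (level_weight K x))"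
proof -
  have mono: "mono (\<lambda>n. real K ^ n)"
    using K_pos by (intro monoI power_increasing) auto
  have "(\<Sum>a\<in>A. star_mass a) = (\<Sum>x\<in>levels. \<Sum>a\<in>A. other_dens a x * dens (star a) x)"
    unfolding star_mass_def by (rule sum.swap)
  also have "\<dots> \<le> (\<Sum>x\<in>levels. joint_dens x * OPT E (level_weight K x))"
  proof (rule sum_mono)
    fix x
    have "(\<Sum>a\<in>A. other_dens a x * dens (star a) x) =
        (\<Sum>a\<in>A. joint_dens x * Max (level_weight K x ` star a))"
    proof (intro sum.cong refl)
      fix a assume a: "a \<in> A"
      have "Max (level_weight K x ` star a) = real K ^ Max (x ` star a)"
        unfolding level_weight_def image_comp[symmetric]
        by (rule mono_Max_commute[OF mono, symmetric]) (use star_nonempty[OF d_pos a] in auto)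
      then show "other_dens a x * dens (star a) x = joint_dens x * Max (level_weight K x ` star a)"
        unfolding joint_dens_split[OF a] using K_pos by simp
    qed
    also have "\<dots> = joint_dens x * (\<Sum>a\<in>A. Max (level_weight K x ` star a))"
      by (simp only: sum_distrib_left)
    also have "\<dots> \<le> joint_dens x * OPT E (level_weight K x)"
      by (intro mult_left_mono OPT_ge[OF d_pos] joint_dens_nonneg)
    finally show "(\<Sum>a\<in>A. other_dens a x * dens (star a) x) \<le> joint_dens x * OPT E (level_weight K x)" .
  qed
  finally show ?thesis .
qed

text \<open>Each star receives the levels 1 to \<open>d\<close>, which are in range. This makes the
  normalising constant of the tilted distribution positive.\<close>

lemma ex_joint_dens_pos: "\<exists>x\<in>levels. 0 < joint_dens x"
proof -
  have "\<forall>a\<in>A. \<exists>f. bij_betw f (star a) {1..d}"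
    using star_nonempty[OF d_pos] star_card by (intro ballI finite_same_card_bij) auto
  from bchoice[OF this] obtain f where f: "\<And>a. a \<in> A \<Longrightarrow> bij_betw (f a) (star a) {1..d}" by blast
  define x where "x = (\<lambda>e\<in>E. f (THE a. a \<in> A \<and> a \<in> e) e)"
  have x: "x e = f a e" if "a \<in> A" "e \<in> star a" for a e
  proof -
    have "(THE a. a \<in> A \<and> a \<in> e) = a"
      using that edge_star_unique[of e] by (intro the1_equality) auto
    then show ?thesis using that by (simp add: x_def)
  qed
  have "x \<in> levels"
    unfolding levels_def
  proof (rule PiE_I)
    fix e assume e: "e \<in> E"
    then obtain a where "a \<in> A" "a \<in> e" using edge_star_unique by blast
    then show "x e \<in> {1..N}" using x[of a e] e bij_betwE[OF f[of a]] d_le_N by fastforce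
  qed (simp add: x_def)
  moreover have "0 < joint_dens x"
    unfolding joint_dens_def
  proof (rule prod_pos)
    fix a assume a: "a \<in> A"
    have "inj_on x (star a)"
      using bij_betw_imp_inj_on[OF f[OF a]] inj_on_cong[of "star a" x "f a"] x[OF a] by blast
    then show "0 < local_dens a x"
      using K_pos d_pos star_card[OF a] by (simp add: local_dens_def dens_def seq_mass_def)
  qed
  ultimately show ?thesis by blast
qed

end


section \<open>From densities to a probability distribution on weights\<close>

lemma acyclic_singleton: "acyclic_edges {e}"
  unfolding acyclic_edges_def
proof
  assume "\<exists>vs. is_cycle {e} vs"
  then obtain vs where vs: "is_cycle {e} vs" ..
  then have "vs \<noteq> []" by (auto simp: is_cycle_def)
  then have "hd vs \<in> set vs" by simp
  then obtain e1 e2 where "e1 \<in> {e}" "e2 \<in> {e}" "e1 \<noteq> e2" by (rule cycle_edges_at[OF vs])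
  then show False by simp
qed

lemma OPT_pos:
  assumes "simple_graph E" "E \<noteq> {}" "pos_weights E w"
  shows "0 < OPT E w"
proof -
  obtain e where e: "e \<in> E" using assms by blast
  then have "sum w {e} \<in> {sum w F | F. F \<subseteq> E \<and> acyclic_edges F}"
    using acyclic_singleton by blast
  moreover have "finite {sum w F | F. F \<subseteq> E \<and> acyclic_edges F}"
    by (rule finite_subset[of _ "sum w ` Pow E"]) (use assms in \<open>auto simp: simple_graph_def\<close>)
  ultimately have "sum w {e} \<le> OPT E w" unfolding OPT_def by (intro Max_ge)
  then show ?thesis using e assms by (simp add: pos_weights_def) (meson less_le_trans)
qed

lemma exp_gain_nonneg:
  assumes "valid_policy p" "\<And>e. e \<in> set es \<Longrightarrow> 0 \<le> w e"
  shows "0 \<le> exp_gain p w h es"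
  using assms(2)
proof (induction es arbitrary: h)
  case (Cons e es)
  then show ?case
    unfolding exp_gain_Cons using acc_prob_bounds[OF assms(1)]
    by (intro add_nonneg_nonneg mult_nonneg_nonneg) auto
qed simp

lemma finite_arrival_orders: "finite E \<Longrightarrow> finite (arrival_orders E)"
  unfolding arrival_orders_def
  by (rule finite_subset[OF _ finite_subset_distinct[of E]]) auto

lemma arrival_orders_nonempty: "finite E \<Longrightarrow> arrival_orders E \<noteq> {}"
  using finite_distinct_list[of E] by (auto simp: arrival_orders_def)

lemma ALG_eq_average:
  assumes "finite E"
  shows "ALG p E w = (\<Sum>xs\<in>arrival_orders E. exp_gain p w [] xs) / card (arrival_orders E)"
  unfolding ALG_def
  using finite_arrival_orders[OF assms] arrival_orders_nonempty[OF assms]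
  by (intro integral_pmf_of_set)

lemma ALG_nonneg:
  assumes "finite E" "valid_policy p" "pos_weights E w"
  shows "0 \<le> ALG p E w"
  unfolding ALG_eq_average[OF assms(1)]
proof (intro divide_nonneg_nonneg sum_nonneg exp_gain_nonneg assms(2))
  fix xs e assume "xs \<in> arrival_orders E" "e \<in> set xs"
  then show "0 \<le> w e"
    using assms(3) by (auto simp: arrival_orders_def pos_weights_def less_imp_le)
qed simp

lemma ex_pmf_of_weights:
  assumes X: "finite X" and nonneg: "\<And>x. x \<in> X \<Longrightarrow> 0 \<le> f x" and sum: "sum f X = 1"
  shows "\<exists>D. set_pmf D \<subseteq> X \<and> (\<forall>x\<in>X. pmf D x = f x)"
proof -
  define f' where "f' x = (if x \<in> X then f x else 0)" for x
  have n: "0 \<le> f' x" for x using nonneg by (simp add: f'_def)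
  have "(\<integral>\<^sup>+x. ennreal (f' x) \<partial>count_space UNIV) = (\<Sum>x\<in>X. ennreal (f' x))"
    by (rule nn_integral_count_space'[OF X]) (auto simp: f'_def)
  also have "\<dots> = 1" using nonneg sum by (simp add: sum_ennreal f'_def)
  finally have one: "(\<integral>\<^sup>+x. ennreal (f' x) \<partial>count_space UNIV) = 1" .
  show ?thesis
    using pmf_embed_pmf[of f', OF n one] set_embed_pmf[of f', OF n one]
    by (intro exI[of _ "embed_pmf f'"]) (auto simp: f'_def)
qed

lemma (in weighted_star_graph) ex_hard_weights:
  fixes \<delta> :: real
  defines "C \<equiv> 1 / exp 1 + ln d / d"
  assumes d6: "6 \<le> d" and A: "A \<noteq> {}"
    and N: "C * (\<Sum>v\<in>{1..N}. 1 / real v) \<le> (C + \<delta>) * (\<Sum>v\<in>{d..N}. 1 / real v)"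
    and K: "1 / real K \<le> \<delta>" and AB: "real K ^ N * card B \<le> \<delta> * card A"
  shows "\<exists>D :: weight pmf. finite (set_pmf D) \<and> (\<forall>w\<in>set_pmf D. pos_weights E w) \<and>
    (\<forall>p. valid_policy p \<longrightarrow>
       measure_pmf.expectation D (\<lambda>w. ALG p E w / OPT E w) \<le> C + 3 * \<delta>)"
proof -
  have K0: "0 < real K" using K_pos by simp
  have pos: "pos_weights E (level_weight K x)" for x
    using K0 by (simp add: pos_weights_def level_weight_def)
  have "E \<noteq> {}" using A star_nonempty[OF d_pos] by blast
  then have OPT: "0 < OPT E (level_weight K x)" for x
    by (rule OPT_pos[OF simple_graph_E _ pos])
  define Z where "Z = (\<Sum>x\<in>levels. joint_dens x * OPT E (level_weight K x))"
  have "0 < Z"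
  proof -
    obtain x where "x \<in> levels" "0 < joint_dens x" using ex_joint_dens_pos by blast
    then show ?thesis
      unfolding Z_def using OPT joint_dens_nonneg finite_levels
      by (intro sum_pos2[of levels x]) (auto intro: mult_nonneg_nonneg less_imp_le)
  qed
  define P where "P x = joint_dens x * OPT E (level_weight K x) / Z" for x
  have "\<exists>D. set_pmf D \<subseteq> levels \<and> (\<forall>x\<in>levels. pmf D x = P x)"
  proof (rule ex_pmf_of_weights[OF finite_levels])
    show "0 \<le> P x" for x
      using OPT[of x] joint_dens_nonneg[of x] \<open>0 < Z\<close> by (simp add: P_def)
    show "sum P levels = 1"
      using \<open>0 < Z\<close> unfolding P_def by (simp add: sum_divide_distrib[symmetric] Z_def)
  qed
  then obtain D where D: "set_pmf D \<subseteq> levels" "\<And>x. x \<in> levels \<Longrightarrow> pmf D x = P x" by blast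
  have "measure_pmf.expectation (map_pmf (level_weight K) D) (\<lambda>w. ALG p E w / OPT E w) \<le> C + 3 * \<delta>"
    if p: "valid_policy p" for p
  proof -
    let ?O = "arrival_orders E"
    have O: "0 < card ?O"
      using finite_arrival_orders arrival_orders_nonempty finite_E by (simp add: card_gt_0_iff)
    have m: "0 \<le> star_mass a" for a
      unfolding star_mass_def by (intro sum_nonneg mult_nonneg_nonneg other_dens_nonneg dens_nonneg)
    have \<delta>0: "0 \<le> \<delta>" using K K0 by (meson divide_nonneg_pos order_trans zero_le_one)
    have C0: "0 \<le> C" unfolding C_def using d6 by (intro add_nonneg_nonneg) auto
    have "(\<Sum>x\<in>levels. joint_dens x * ALG p E (level_weight K x)) =
        (\<Sum>x\<in>levels. \<Sum>xs\<in>?O. joint_dens x * exp_gain p (level_weight K x) [] xs) / card ?O"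
      by (simp add: ALG_eq_average[OF finite_E] sum_divide_distrib sum_distrib_left)
    also have "(\<Sum>x\<in>levels. \<Sum>xs\<in>?O. joint_dens x * exp_gain p (level_weight K x) [] xs) =
        (\<Sum>xs\<in>?O. \<Sum>x\<in>levels. joint_dens x * exp_gain p (level_weight K x) [] xs)"
      by (rule sum.swap)
    also have "\<dots> / card ?O \<le> (\<Sum>xs\<in>?O. (C + 3 * \<delta>) * (\<Sum>a\<in>A. star_mass a)) / card ?O"
      using sum_exp_gain_le[OF p d6 _ N[unfolded C_def] K AB] unfolding C_def
      by (intro divide_right_mono sum_mono) auto
    also have "\<dots> = (C + 3 * \<delta>) * (\<Sum>a\<in>A. star_mass a)" using O by simp
    also have "\<dots> \<le> (C + 3 * \<delta>) * Z"
      unfolding Z_def using C0 \<delta>0 by (intro mult_left_mono sum_OPT_ge) auto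
    finally have num: "(\<Sum>x\<in>levels. joint_dens x * ALG p E (level_weight K x)) \<le> (C + 3 * \<delta>) * Z" .
    have "measure_pmf.expectation (map_pmf (level_weight K) D) (\<lambda>w. ALG p E w / OPT E w) =
        measure_pmf.expectation D (\<lambda>x. ALG p E (level_weight K x) / OPT E (level_weight K x))"
      by simp
    also have "\<dots> = (\<Sum>x\<in>levels. pmf D x *\<^sub>R (ALG p E (level_weight K x) / OPT E (level_weight K x)))"
      by (rule integral_measure_pmf[OF finite_levels]) (use D in auto)
    also have "\<dots> = (\<Sum>x\<in>levels. joint_dens x * ALG p E (level_weight K x) / Z)"
    proof (intro sum.cong refl)
      fix x assume "x \<in> levels"
      then show "pmf D x *\<^sub>R (ALG p E (level_weight K x) / OPT E (level_weight K x)) =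
          joint_dens x * ALG p E (level_weight K x) / Z"
        using D(2) OPT[of x] by (simp add: P_def)
    qed
    also have "\<dots> = (\<Sum>x\<in>levels. joint_dens x * ALG p E (level_weight K x)) / Z"
      by (simp only: sum_divide_distrib)
    also have "\<dots> \<le> C + 3 * \<delta>" using num \<open>0 < Z\<close> by (simp add: field_simps)
    finally show ?thesis .
  qed
  moreover have "finite (set_pmf (map_pmf (level_weight K) D))"
    using finite_subset[OF D(1) finite_levels] by simp
  ultimately show ?thesis using pos by (intro exI[of _ "map_pmf (level_weight K) D"]) auto
qed

section \<open>Choice of the parameters and the competitive ratio\<close>

lemma ex_hard_instance:
  fixes \<epsilon> :: real and g :: int
  assumes "0 < \<epsilon>"
  shows "\<exists>E (D :: weight pmf).
            simple_graph E \<and> E \<noteq> {} \<and> girth_at_least E g \<and>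
            finite (set_pmf D) \<and> (\<forall>w\<in>set_pmf D. pos_weights E w) \<and>
            (\<forall>p. valid_policy p \<longrightarrow>
               measure_pmf.expectation D (\<lambda>w. ALG p E w / OPT E w) < 1 / exp 1 + \<epsilon>)"
proof -
  \<comment> \<open>Five parts: one for \<open>ln d / d\<close>, three for the losses in
    \<open>ex_hard_weights\<close>, one to make the inequality strict.\<close>
  define \<delta> where "\<delta> = \<epsilon> / 5"
  have \<delta>: "0 < \<delta>" using assms by (simp add: \<delta>_def)
  obtain d :: nat where d: "6 \<le> d" "ln (real d) / real d \<le> \<delta>" by (rule ex_ln_over_n_le[OF \<delta>])
  define C where "C = 1 / exp 1 + ln (real d) / real d"
  have C0: "0 \<le> C" unfolding C_def using d by (intro add_nonneg_nonneg) auto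
  obtain N where N: "d \<le> N"
    "C * (\<Sum>v\<in>{1..N}. 1 / real v) \<le> (C + \<delta>) * (\<Sum>v\<in>{d..N}. 1 / real v)"
    by (rule ex_harmonic_tail_ratio[OF C0 \<delta>])
  define K where "K = Suc (nat \<lceil>1 / \<delta>\<rceil>)"
  have "1 / \<delta> \<le> real K" "0 < real K" unfolding K_def by linarith+
  then have K: "1 / real K \<le> \<delta>" using \<delta> by (simp add: field_simps)
  \<comment> \<open>Chosen after \<open>N\<close> and \<open>K\<close>: with \<open>card A\<close>
    at least \<open>Q * card B\<close>, even surplus edges of the largest weight
    \<open>K ^ N\<close> are negligible.\<close>
  define Q where "Q = Suc (nat \<lceil>real K ^ N / \<delta>\<rceil>)"
  have "real K ^ N / \<delta> \<le> real Q" unfolding Q_def by linarith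
  then have Q: "real K ^ N \<le> \<delta> * real Q" using \<delta> by (simp add: field_simps)
  have "0 < Q" "0 < d" using d by (auto simp: Q_def)
  from ex_star_graph[OF this, of "nat g"] obtain A B E where sg: "star_graph A B E d"
    and girth: "cycles_at_least E (nat g)" and B: "B \<noteq> {}" and AB: "Q * card B \<le> card A"
    by blast
  interpret star_graph A B E d by (rule sg)
  interpret weighted_star_graph A B E d N K
    by unfold_locales (use N d in \<open>auto simp: K_def\<close>)
  have "0 < card A" using AB B finite_parts \<open>0 < Q\<close>
    by (metis card_gt_0_iff less_le_trans nat_0_less_mult_iff)
  then have A: "A \<noteq> {}" by auto
  have "real K ^ N * card B \<le> \<delta> * (real Q * card B)"
    using mult_right_mono[OF Q, of "real (card B)"] by (simp add: mult.assoc)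
  also have "real Q * card B \<le> card A"
    using AB by (metis of_nat_le_iff of_nat_mult)
  finally have KAB: "real K ^ N * card B \<le> \<delta> * card A" using \<delta> by simp
  obtain D :: "weight pmf" where D: "finite (set_pmf D)" "\<forall>w\<in>set_pmf D. pos_weights E w"
    "\<And>p. valid_policy p \<Longrightarrow>
       measure_pmf.expectation D (\<lambda>w. ALG p E w / OPT E w) \<le> C + 3 * \<delta>"
    using ex_hard_weights[OF d(1) A N(2)[unfolded C_def] K KAB] unfolding C_def by blast
  have "C + 3 * \<delta> < 1 / exp 1 + \<epsilon>" using d(2) assms unfolding C_def \<delta>_def by linarith
  then have "\<forall>p. valid_policy p \<longrightarrow>
      measure_pmf.expectation D (\<lambda>w. ALG p E w / OPT E w) < 1 / exp 1 + \<epsilon>"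
    using D(3) le_less_trans by blast
  moreover have "girth_at_least E g"
    using girth by (fastforce simp: girth_at_least_def cycles_at_least_def)
  moreover have "E \<noteq> {}" using A star_nonempty[OF \<open>0 < d\<close>] by blast
  ultimately show ?thesis using D(1,2) simple_graph_E by blast
qed

theorem theorem3:
  shows "(\<forall>\<epsilon>::real > 0. \<forall>g::int. \<exists>E (D :: weight pmf).
            simple_graph E \<and> E \<noteq> {} \<and> girth_at_least E g \<and>
            finite (set_pmf D) \<and> (\<forall>w\<in>set_pmf D. pos_weights E w) \<and>
            (\<forall>p. valid_policy p \<longrightarrow>
               measure_pmf.expectation D (\<lambda>w. ALG p E w / OPT E w) < 1 / exp 1 + \<epsilon>))
       \<and> (\<forall>g::int. \<forall>\<alpha>::real. \<alpha> < exp 1 \<longrightarrow>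
            \<not> (\<exists>A :: edge set \<Rightarrow> policy.
                  (\<forall>E. valid_policy (A E)) \<and>
                  (\<forall>E w. simple_graph E \<and> girth_at_least E g \<and> pos_weights E w \<longrightarrow>
                         \<alpha> * ALG (A E) E w \<ge> OPT E w)))"
proof (intro conjI allI impI notI)
  fix \<epsilon> :: real and g :: int
  assume "0 < \<epsilon>"
  then show "\<exists>E (D :: weight pmf).
            simple_graph E \<and> E \<noteq> {} \<and> girth_at_least E g \<and>
            finite (set_pmf D) \<and> (\<forall>w\<in>set_pmf D. pos_weights E w) \<and>
            (\<forall>p. valid_policy p \<longrightarrow>
               measure_pmf.expectation D (\<lambda>w. ALG p E w / OPT E w) < 1 / exp 1 + \<epsilon>)"
    by (rule ex_hard_instance)
next
  fix g :: int and \<alpha> :: real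
  assume \<alpha>: "\<alpha> < exp 1"
  assume "\<exists>A :: edge set \<Rightarrow> policy. (\<forall>E. valid_policy (A E)) \<and>
      (\<forall>E w. simple_graph E \<and> girth_at_least E g \<and> pos_weights E w \<longrightarrow>
         \<alpha> * ALG (A E) E w \<ge> OPT E w)"
  then obtain A :: "edge set \<Rightarrow> policy" where valid: "\<And>E. valid_policy (A E)"
    and comp: "\<And>E w. simple_graph E \<Longrightarrow> girth_at_least E g \<Longrightarrow> pos_weights E w \<Longrightarrow>
         OPT E w \<le> \<alpha> * ALG (A E) E w" by blast
  \<comment> \<open>For positive \<alpha> this turns the bound into \<open>1 / \<alpha>\<close>. The
    value 1 is a placeholder for the remaining case, which positivity of \<open>OPT\<close> and
    nonnegativity of \<open>ALG\<close> exclude afterwards.\<close>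
  define \<epsilon> where "\<epsilon> = (if 0 < \<alpha> then 1 / \<alpha> - 1 / exp 1 else 1)"
  have "0 < \<epsilon>" using \<alpha> by (simp add: \<epsilon>_def frac_less2)
  from ex_hard_instance[OF this, of g] obtain E and D :: "weight pmf" where
    E: "simple_graph E" "E \<noteq> {}" "girth_at_least E g" and
    D: "finite (set_pmf D)" "\<And>w. w \<in> set_pmf D \<Longrightarrow> pos_weights E w" and
    less: "\<And>p. valid_policy p \<Longrightarrow>
       measure_pmf.expectation D (\<lambda>w. ALG p E w / OPT E w) < 1 / exp 1 + \<epsilon>"
    by blast
  have OPT: "0 < OPT E w" "OPT E w \<le> \<alpha> * ALG (A E) E w" "0 \<le> ALG (A E) E w"
    if "w \<in> set_pmf D" for w
    using OPT_pos[OF E(1,2) D(2)[OF that]] comp[OF E(1,3) D(2)[OF that]]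
      ALG_nonneg[OF _ valid D(2)[OF that]] E(1) by (auto simp: simple_graph_def)
  obtain w0 where "w0 \<in> set_pmf D" using set_pmf_not_empty by fastforce
  from OPT[OF this] have "0 < \<alpha> * ALG (A E) E w0" "0 \<le> ALG (A E) E w0" by auto
  then have \<alpha>0: "0 < \<alpha>" by (simp add: zero_less_mult_iff)
  have "1 / \<alpha> \<le> ALG (A E) E w / OPT E w" if "w \<in> set_pmf D" for w
    using OPT[OF that] \<alpha>0 by (simp add: field_simps)
  then have "1 / \<alpha> \<le> measure_pmf.expectation D (\<lambda>w. ALG (A E) E w / OPT E w)"
    using D(1) by (intro measure_pmf.integral_ge_const integrable_measure_pmf_finite AE_pmfI)
  also have "\<dots> < 1 / exp 1 + \<epsilon>" by (rule less[OF valid])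
  also have "\<dots> = 1 / \<alpha>" using \<alpha>0 by (simp add: \<epsilon>_def)
  finally show False by simp
qed

end
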